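(* Let $\Gamma$ be a virtually torsion-free discrete group having only finitely many finite subgroups up to conjugacy. If $K_0(\mathbb{C}[\Gamma])\cong\mathbb{Z}$, then $\Gamma$ is torsion-free.
   Context: A group is virtually torsion-free if it contains a torsion-free subgroup of finite index. $K_0(\mathbb{C}[\Gamma])$ is the Grothendieck group of finitely generated projective $\mathbb{C}[\Gamma]$-modules. *)

theory Defs
  imports Complex_Main "HOL-Algebra.Algebra"
begin

section \<open>Group-theoretic notions\<close>

definition torsion_free :: "('g, 'b) monoid_scheme \<Rightarrow> bool"
  where "torsion_free G \<longleftrightarrow>
    (\<forall>x\<in>carrier G. \<forall>n::nat. 0 < n \<and> x [^]\<^bsub>G\<^esub> n = \<one>\<^bsub>G\<^esub> \<longrightarrow> x = \<one>\<^bsub>G\<^esub>)"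

definition virtually_torsion_free :: "('g, 'b) monoid_scheme \<Rightarrow> bool"
  where "virtually_torsion_free G \<longleftrightarrow>
    (\<exists>H. subgroup H G \<and> finite (rcosets\<^bsub>G\<^esub> H) \<and> torsion_free (G\<lparr>carrier := H\<rparr>))"

definition finite_subgroups :: "('g, 'b) monoid_scheme \<Rightarrow> 'g set set"
  where "finite_subgroups G = {H. subgroup H G \<and> finite H}"

definition finite_subgroup_conjugacy_classes :: "('g, 'b) monoid_scheme \<Rightarrow> 'g set set set"
  where "finite_subgroup_conjugacy_classes G =
    orbits G (finite_subgroups G)
      (\<lambda>g. \<lambda>H\<in>finite_subgroups G. g <#\<^bsub>G\<^esub> H #>\<^bsub>G\<^esub> (inv\<^bsub>G\<^esub> g))"


section \<open>The complex group algebra\<close>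

text \<open>
  Elements are finitely supported functions on the carrier, extended by zero to the whole type;
  the product is convolution.
\<close>

definition group_algebra :: "('g, 'b) monoid_scheme \<Rightarrow> ('g \<Rightarrow> complex) ring"
  where "group_algebra G =
    \<lparr>carrier = {f. finite {x. f x \<noteq> 0} \<and> {x. f x \<noteq> 0} \<subseteq> carrier G},
     monoid.mult = (\<lambda>f h x. \<Sum>(y, z)\<in>{(y, z). f y \<noteq> 0 \<and> h z \<noteq> 0 \<and> y \<otimes>\<^bsub>G\<^esub> z = x}. f y * h z),
     one = (\<lambda>x. if x = \<one>\<^bsub>G\<^esub> then 1 else 0),
     ring.zero = (\<lambda>x. 0),
     ring.add = (\<lambda>f h x. f x + h x)\<rparr>"

lemma group_algebra_mult_eq:
  assumes "finite A" "finite B" "{x. f x \<noteq> 0} \<subseteq> A" "{x. h x \<noteq> 0} \<subseteq> B"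
  shows "(f \<otimes>\<^bsub>group_algebra G\<^esub> h) x =
    (\<Sum>y\<in>A. \<Sum>z\<in>B. if y \<otimes>\<^bsub>G\<^esub> z = x then f y * h z else 0)"
proof -
  have "(f \<otimes>\<^bsub>group_algebra G\<^esub> h) x =
      (\<Sum>(y, z)\<in>A \<times> B. if y \<otimes>\<^bsub>G\<^esub> z = x then f y * h z else 0)"
    unfolding group_algebra_def monoid.simps
    by (rule sum.mono_neutral_cong_left) (use assms in \<open>auto split: if_splits\<close>)
  then show ?thesis
    by (simp add: sum.cartesian_product)
qed

lemma group_algebra_mult_closed:
  assumes "group G" "f \<in> carrier (group_algebra G)" "h \<in> carrier (group_algebra G)"
  shows "f \<otimes>\<^bsub>group_algebra G\<^esub> h \<in> carrier (group_algebra G)"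
proof -
  interpret group G by fact
  let ?A = "{x. f x \<noteq> 0}" and ?B = "{x. h x \<noteq> 0}"
  have fin: "finite ?A" "finite ?B" and sub: "?A \<subseteq> carrier G" "?B \<subseteq> carrier G"
    using assms by (auto simp: group_algebra_def)
  have "{x. (f \<otimes>\<^bsub>group_algebra G\<^esub> h) x \<noteq> 0} \<subseteq> (\<lambda>(y, z). y \<otimes>\<^bsub>G\<^esub> z) ` (?A \<times> ?B)"
  proof
    fix x assume x: "x \<in> {x. (f \<otimes>\<^bsub>group_algebra G\<^esub> h) x \<noteq> 0}"
    show "x \<in> (\<lambda>(y, z). y \<otimes>\<^bsub>G\<^esub> z) ` (?A \<times> ?B)"
    proof (rule ccontr)
      assume "x \<notin> (\<lambda>(y, z). y \<otimes>\<^bsub>G\<^esub> z) ` (?A \<times> ?B)"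
      then have "\<And>y z. y \<in> ?A \<Longrightarrow> z \<in> ?B \<Longrightarrow> y \<otimes>\<^bsub>G\<^esub> z \<noteq> x"
        by force
      then have "(f \<otimes>\<^bsub>group_algebra G\<^esub> h) x = 0"
        unfolding group_algebra_mult_eq[OF fin order_refl order_refl]
        by (intro sum.neutral ballI) simp
      then show False using x by simp
    qed
  qed
  moreover have "(\<lambda>(y, z). y \<otimes>\<^bsub>G\<^esub> z) ` (?A \<times> ?B) \<subseteq> carrier G"
    using sub by auto
  moreover have "finite ((\<lambda>(y, z). y \<otimes>\<^bsub>G\<^esub> z) ` (?A \<times> ?B))"
    using fin by blast
  ultimately have "{x. (f \<otimes>\<^bsub>group_algebra G\<^esub> h) x \<noteq> 0} \<subseteq> carrier G"
    and "finite {x. (f \<otimes>\<^bsub>group_algebra G\<^esub> h) x \<noteq> 0}"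
    by (blast intro: finite_subset)+
  then show ?thesis
    by (simp add: group_algebra_def)
qed

lemma group_algebra_mult_assoc:
  assumes "group G" "f \<in> carrier (group_algebra G)" "h \<in> carrier (group_algebra G)"
    "k \<in> carrier (group_algebra G)"
  shows "(f \<otimes>\<^bsub>group_algebra G\<^esub> h) \<otimes>\<^bsub>group_algebra G\<^esub> k =
    f \<otimes>\<^bsub>group_algebra G\<^esub> (h \<otimes>\<^bsub>group_algebra G\<^esub> k)"
proof
  fix x
  interpret group G by fact
  let ?A = "{x. f x \<noteq> 0}" and ?B = "{x. h x \<noteq> 0}" and ?C = "{x. k x \<noteq> 0}"
  define D where "D = {x. (f \<otimes>\<^bsub>group_algebra G\<^esub> h) x \<noteq> 0} \<union> (\<lambda>(y, z). y \<otimes>\<^bsub>G\<^esub> z) ` (?A \<times> ?B)"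
  define E where "E = {x. (h \<otimes>\<^bsub>group_algebra G\<^esub> k) x \<noteq> 0} \<union> (\<lambda>(y, z). y \<otimes>\<^bsub>G\<^esub> z) ` (?B \<times> ?C)"
  have fin: "finite ?A" "finite ?B" "finite ?C"
    and sub: "?A \<subseteq> carrier G" "?B \<subseteq> carrier G" "?C \<subseteq> carrier G"
    using assms by (auto simp: group_algebra_def)
  have "finite {x. (f \<otimes>\<^bsub>group_algebra G\<^esub> h) x \<noteq> 0}" "finite {x. (h \<otimes>\<^bsub>group_algebra G\<^esub> k) x \<noteq> 0}"
    using group_algebra_mult_closed[OF assms(1)] assms(2-)
    by (auto simp: group_algebra_def)
  then have finDE: "finite D" "finite E"
    using fin by (auto simp: D_def E_def)
  have inD: "a \<otimes>\<^bsub>G\<^esub> b \<in> D" if "a \<in> ?A" "b \<in> ?B" for a b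
    using that by (auto simp: D_def)
  have inE: "b \<otimes>\<^bsub>G\<^esub> c \<in> E" if "b \<in> ?B" "c \<in> ?C" for b c
    using that by (auto simp: E_def)
  have "((f \<otimes>\<^bsub>group_algebra G\<^esub> h) \<otimes>\<^bsub>group_algebra G\<^esub> k) x =
      (\<Sum>d\<in>D. \<Sum>c\<in>?C. if d \<otimes>\<^bsub>G\<^esub> c = x then (f \<otimes>\<^bsub>group_algebra G\<^esub> h) d * k c else 0)"
    by (rule group_algebra_mult_eq) (use fin finDE in \<open>auto simp: D_def\<close>)
  also have "\<dots> = (\<Sum>d\<in>D. \<Sum>c\<in>?C. \<Sum>a\<in>?A. \<Sum>b\<in>?B.
      if a \<otimes>\<^bsub>G\<^esub> b = d then if d \<otimes>\<^bsub>G\<^esub> c = x then f a * h b * k c else 0 else 0)"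
    unfolding group_algebra_mult_eq[OF fin(1,2) order_refl order_refl]
    by (intro sum.cong refl) (auto simp: sum_distrib_right cong: if_cong intro!: sum.cong)
  also have "\<dots> = (\<Sum>c\<in>?C. \<Sum>a\<in>?A. \<Sum>b\<in>?B. \<Sum>d\<in>D.
      if a \<otimes>\<^bsub>G\<^esub> b = d then if d \<otimes>\<^bsub>G\<^esub> c = x then f a * h b * k c else 0 else 0)"
    unfolding sum.swap[of _ _ D] ..
  also have "\<dots> = (\<Sum>c\<in>?C. \<Sum>a\<in>?A. \<Sum>b\<in>?B.
      if (a \<otimes>\<^bsub>G\<^esub> b) \<otimes>\<^bsub>G\<^esub> c = x then f a * h b * k c else 0)"
    using inD finDE by (intro sum.cong refl) (simp add: sum.delta')
  also have "\<dots> = (\<Sum>a\<in>?A. \<Sum>b\<in>?B. \<Sum>c\<in>?C.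
      if (a \<otimes>\<^bsub>G\<^esub> b) \<otimes>\<^bsub>G\<^esub> c = x then f a * h b * k c else 0)"
    unfolding sum.swap[of _ _ ?C] ..
  also have "\<dots> = (\<Sum>a\<in>?A. \<Sum>b\<in>?B. \<Sum>c\<in>?C.
      if a \<otimes>\<^bsub>G\<^esub> (b \<otimes>\<^bsub>G\<^esub> c) = x then f a * h b * k c else 0)"
  proof (intro sum.cong refl)
    fix a b c assume "a \<in> ?A" "b \<in> ?B" "c \<in> ?C"
    then have "(a \<otimes>\<^bsub>G\<^esub> b) \<otimes>\<^bsub>G\<^esub> c = a \<otimes>\<^bsub>G\<^esub> (b \<otimes>\<^bsub>G\<^esub> c)"
      using sub by (intro m_assoc) auto
    then show "(if (a \<otimes>\<^bsub>G\<^esub> b) \<otimes>\<^bsub>G\<^esub> c = x then f a * h b * k c else 0) =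
        (if a \<otimes>\<^bsub>G\<^esub> (b \<otimes>\<^bsub>G\<^esub> c) = x then f a * h b * k c else 0)"
      by simp
  qed
  also have "\<dots> = (\<Sum>a\<in>?A. \<Sum>b\<in>?B. \<Sum>c\<in>?C. \<Sum>e\<in>E.
      if b \<otimes>\<^bsub>G\<^esub> c = e then if a \<otimes>\<^bsub>G\<^esub> e = x then f a * h b * k c else 0 else 0)"
    using inE finDE by (intro sum.cong refl) (simp add: sum.delta')
  also have "\<dots> = (\<Sum>a\<in>?A. \<Sum>e\<in>E. \<Sum>b\<in>?B. \<Sum>c\<in>?C.
      if b \<otimes>\<^bsub>G\<^esub> c = e then if a \<otimes>\<^bsub>G\<^esub> e = x then f a * h b * k c else 0 else 0)"
    unfolding sum.swap[of _ E] ..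
  also have "\<dots> = (\<Sum>a\<in>?A. \<Sum>e\<in>E.
      if a \<otimes>\<^bsub>G\<^esub> e = x then f a * (h \<otimes>\<^bsub>group_algebra G\<^esub> k) e else 0)"
    unfolding group_algebra_mult_eq[OF fin(2,3) order_refl order_refl]
    by (intro sum.cong refl) (auto simp: sum_distrib_left mult.assoc cong: if_cong intro!: sum.cong)
  also have "\<dots> = (f \<otimes>\<^bsub>group_algebra G\<^esub> (h \<otimes>\<^bsub>group_algebra G\<^esub> k)) x"
    by (rule group_algebra_mult_eq[symmetric]) (use fin finDE in \<open>auto simp: E_def\<close>)
  finally show "((f \<otimes>\<^bsub>group_algebra G\<^esub> h) \<otimes>\<^bsub>group_algebra G\<^esub> k) x =
    (f \<otimes>\<^bsub>group_algebra G\<^esub> (h \<otimes>\<^bsub>group_algebra G\<^esub> k)) x" .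
qed

lemma ring_group_algebra:
  assumes "group G"
  shows "ring (group_algebra G)"
proof (rule ringI)
  interpret group G by fact
  let ?R = "group_algebra G"
  have add_closed: "f \<oplus>\<^bsub>?R\<^esub> h \<in> carrier ?R" if "f \<in> carrier ?R" "h \<in> carrier ?R" for f h
  proof -
    have "{x. f x + h x \<noteq> 0} \<subseteq> {x. f x \<noteq> 0} \<union> {x. h x \<noteq> 0}"
      by auto
    then show ?thesis
      using that by (auto simp: group_algebra_def intro: finite_subset)
  qed
  show "abelian_group ?R"
  proof (rule abelian_groupI)
    fix f assume "f \<in> carrier ?R"
    then show "\<exists>h\<in>carrier ?R. h \<oplus>\<^bsub>?R\<^esub> f = \<zero>\<^bsub>?R\<^esub>"
      by (intro bexI[of _ "\<lambda>x. - f x"]) (auto simp: group_algebra_def)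
  qed (use add_closed in \<open>auto simp: group_algebra_def algebra_simps\<close>)
  show "Group.monoid ?R"
  proof (rule monoidI)
    show one: "\<one>\<^bsub>?R\<^esub> \<in> carrier ?R"
      by (auto simp: group_algebra_def)
    fix f assume f: "f \<in> carrier ?R"
    let ?A = "{x. f x \<noteq> 0}"
    have fin: "finite ?A" and sub: "?A \<subseteq> carrier G"
      using f by (auto simp: group_algebra_def)
    have supp: "{x. \<one>\<^bsub>?R\<^esub> x \<noteq> 0} \<subseteq> {\<one>\<^bsub>G\<^esub>}"
      by (auto simp: group_algebra_def)
    have unit: "(\<Sum>y\<in>?A. if y = x then f y else 0) = f x" for x
      using fin by (simp add: sum.delta)
    show "\<one>\<^bsub>?R\<^esub> \<otimes>\<^bsub>?R\<^esub> f = f"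
    proof
      fix x
      have "(\<one>\<^bsub>?R\<^esub> \<otimes>\<^bsub>?R\<^esub> f) x = (\<Sum>y\<in>?A. if y = x then f y else 0)"
        unfolding group_algebra_mult_eq[OF _ fin supp order_refl, simplified]
        using sub by (auto intro!: sum.cong simp: group_algebra_def)
      then show "(\<one>\<^bsub>?R\<^esub> \<otimes>\<^bsub>?R\<^esub> f) x = f x" by (simp only: unit)
    qed
    show "f \<otimes>\<^bsub>?R\<^esub> \<one>\<^bsub>?R\<^esub> = f"
    proof
      fix x
      have "(f \<otimes>\<^bsub>?R\<^esub> \<one>\<^bsub>?R\<^esub>) x = (\<Sum>y\<in>?A. if y = x then f y else 0)"
        unfolding group_algebra_mult_eq[OF fin _ order_refl supp, simplified]
        using sub by (auto intro!: sum.cong simp: group_algebra_def)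
      then show "(f \<otimes>\<^bsub>?R\<^esub> \<one>\<^bsub>?R\<^esub>) x = f x" by (simp only: unit)
    qed
  qed (use group_algebra_mult_closed[OF assms] group_algebra_mult_assoc[OF assms] in auto)
  fix f h k assume fhk: "f \<in> carrier ?R" "h \<in> carrier ?R" "k \<in> carrier ?R"
  let ?A = "{x. f x \<noteq> 0}" and ?B = "{x. h x \<noteq> 0}" and ?C = "{x. k x \<noteq> 0}"
  have fin: "finite ?A" "finite ?B" "finite ?C"
    using fhk by (auto simp: group_algebra_def)
  have supp: "{x. (f \<oplus>\<^bsub>?R\<^esub> h) x \<noteq> 0} \<subseteq> ?A \<union> ?B"
    by (auto simp: group_algebra_def)
  have add_apply: "(u \<oplus>\<^bsub>?R\<^esub> v) x = u x + v x" for u v x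
    by (simp add: group_algebra_def)
  show "(f \<oplus>\<^bsub>?R\<^esub> h) \<otimes>\<^bsub>?R\<^esub> k = f \<otimes>\<^bsub>?R\<^esub> k \<oplus>\<^bsub>?R\<^esub> h \<otimes>\<^bsub>?R\<^esub> k"
  proof
    fix x
    show "((f \<oplus>\<^bsub>?R\<^esub> h) \<otimes>\<^bsub>?R\<^esub> k) x = (f \<otimes>\<^bsub>?R\<^esub> k \<oplus>\<^bsub>?R\<^esub> h \<otimes>\<^bsub>?R\<^esub> k) x"
      using fin supp
      by (simp add: add_apply group_algebra_mult_eq[of "?A \<union> ?B" ?C] sum.distrib[symmetric]
          algebra_simps cong: if_cong) (auto intro!: sum.cong simp: algebra_simps)
  qed
  show "k \<otimes>\<^bsub>?R\<^esub> (f \<oplus>\<^bsub>?R\<^esub> h) = k \<otimes>\<^bsub>?R\<^esub> f \<oplus>\<^bsub>?R\<^esub> k \<otimes>\<^bsub>?R\<^esub> h"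
  proof
    fix x
    show "(k \<otimes>\<^bsub>?R\<^esub> (f \<oplus>\<^bsub>?R\<^esub> h)) x = (k \<otimes>\<^bsub>?R\<^esub> f \<oplus>\<^bsub>?R\<^esub> k \<otimes>\<^bsub>?R\<^esub> h) x"
      using fin supp
      by (simp add: add_apply group_algebra_mult_eq[of ?C "?A \<union> ?B"] sum.distrib[symmetric]
          algebra_simps cong: if_cong) (auto intro!: sum.cong simp: algebra_simps)
  qed
qed


section \<open>Modules over a not necessarily commutative ring\<close>

text \<open>
  The library's locale \<open>module\<close> requires a commutative ring of scalars. Only its record type is
  reused here; the ring fields \<open>mult\<close> and \<open>one\<close> of that record play no role.
\<close>

locale left_module = R?: ring R + M?: abelian_group M
  for R :: "('r, 'c) ring_scheme" and M :: "('r, 'm, 'd) module_scheme" (structure) +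
  assumes smult_closed:
      "\<lbrakk>a \<in> carrier R; x \<in> carrier M\<rbrakk> \<Longrightarrow> a \<odot>\<^bsub>M\<^esub> x \<in> carrier M"
    and smult_l_distr:
      "\<lbrakk>a \<in> carrier R; b \<in> carrier R; x \<in> carrier M\<rbrakk> \<Longrightarrow>
        (a \<oplus>\<^bsub>R\<^esub> b) \<odot>\<^bsub>M\<^esub> x = a \<odot>\<^bsub>M\<^esub> x \<oplus>\<^bsub>M\<^esub> b \<odot>\<^bsub>M\<^esub> x"
    and smult_r_distr:
      "\<lbrakk>a \<in> carrier R; x \<in> carrier M; y \<in> carrier M\<rbrakk> \<Longrightarrow>
        a \<odot>\<^bsub>M\<^esub> (x \<oplus>\<^bsub>M\<^esub> y) = a \<odot>\<^bsub>M\<^esub> x \<oplus>\<^bsub>M\<^esub> a \<odot>\<^bsub>M\<^esub> y"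
    and smult_assoc:
      "\<lbrakk>a \<in> carrier R; b \<in> carrier R; x \<in> carrier M\<rbrakk> \<Longrightarrow>
        (a \<otimes>\<^bsub>R\<^esub> b) \<odot>\<^bsub>M\<^esub> x = a \<odot>\<^bsub>M\<^esub> (b \<odot>\<^bsub>M\<^esub> x)"
    and smult_one:
      "x \<in> carrier M \<Longrightarrow> \<one>\<^bsub>R\<^esub> \<odot>\<^bsub>M\<^esub> x = x"

definition module_isomorphic ::
    "('r, 'c) ring_scheme \<Rightarrow> ('r, 'm, 'd) module_scheme \<Rightarrow> ('r, 'n, 'e) module_scheme \<Rightarrow> bool"
  where "module_isomorphic R M N \<longleftrightarrow>
    (\<exists>\<phi>. bij_betw \<phi> (carrier M) (carrier N) \<and>
      (\<forall>x\<in>carrier M. \<forall>y\<in>carrier M. \<phi> (x \<oplus>\<^bsub>M\<^esub> y) = \<phi> x \<oplus>\<^bsub>N\<^esub> \<phi> y) \<and>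
      (\<forall>a\<in>carrier R. \<forall>x\<in>carrier M. \<phi> (a \<odot>\<^bsub>M\<^esub> x) = a \<odot>\<^bsub>N\<^esub> \<phi> x))"

definition direct_sum ::
    "('r, 'm, 'd) module_scheme \<Rightarrow> ('r, 'n, 'e) module_scheme \<Rightarrow> ('r, 'm \<times> 'n) module"
  where "direct_sum M N =
    \<lparr>carrier = carrier M \<times> carrier N,
     monoid.mult = undefined, one = undefined,
     ring.zero = (\<zero>\<^bsub>M\<^esub>, \<zero>\<^bsub>N\<^esub>),
     ring.add = (\<lambda>(x, y) (x', y'). (x \<oplus>\<^bsub>M\<^esub> x', y \<oplus>\<^bsub>N\<^esub> y')),
     smult = (\<lambda>a (x, y). (a \<odot>\<^bsub>M\<^esub> x, a \<odot>\<^bsub>N\<^esub> y))\<rparr>"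

definition free_module :: "('r, 'c) ring_scheme \<Rightarrow> 'i set \<Rightarrow> ('r, 'i \<Rightarrow> 'r) module"
  where "free_module R I =
    \<lparr>carrier = {v. (\<forall>i. v i \<in> carrier R) \<and> finite {i. v i \<noteq> \<zero>\<^bsub>R\<^esub>} \<and> {i. v i \<noteq> \<zero>\<^bsub>R\<^esub>} \<subseteq> I},
     monoid.mult = undefined, one = undefined,
     ring.zero = (\<lambda>i. \<zero>\<^bsub>R\<^esub>),
     ring.add = (\<lambda>v w i. v i \<oplus>\<^bsub>R\<^esub> w i),
     smult = (\<lambda>a v i. a \<otimes>\<^bsub>R\<^esub> v i)\<rparr>"

definition finitely_generated :: "('r, 'c) ring_scheme \<Rightarrow> ('r, 'm, 'd) module_scheme \<Rightarrow> bool"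
  where "finitely_generated R M \<longleftrightarrow>
    (\<exists>A. finite A \<and> A \<subseteq> carrier M \<and>
      (\<forall>x\<in>carrier M. \<exists>c\<in>A \<rightarrow> carrier R. x = (\<Oplus>\<^bsub>M\<^esub>a\<in>A. c a \<odot>\<^bsub>M\<^esub> a)))"

text \<open>
  Projective means: direct summand of a free module. Bounding the types of the basis and of the
  complement loses nothing: a projective \<open>M\<close> is a summand of the free module on the set
  \<open>carrier M\<close>, with complement the kernel of the canonical surjection.
\<close>

definition projective :: "('r, 'c) ring_scheme \<Rightarrow> ('r, 'm, 'd) module_scheme \<Rightarrow> bool"
  where "projective R M \<longleftrightarrow>
    (\<exists>(I :: 'm set) (N :: ('r, 'm \<Rightarrow> 'r) module).
      left_module R N \<and> module_isomorphic R (direct_sum M N) (free_module R I))"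


section \<open>The Grothendieck group of finitely generated projective modules\<close>

text \<open>
  Every finitely generated projective module is isomorphic to a submodule of some \<open>R\<^sup>n\<close>, hence to
  one whose elements are functions \<open>nat \<Rightarrow> 'r\<close>; so this set represents all isomorphism classes.
\<close>

definition fg_projectives :: "('r, 'c) ring_scheme \<Rightarrow> ('r, nat \<Rightarrow> 'r) module set"
  where "fg_projectives R = {P. left_module R P \<and> finitely_generated R P \<and> projective R P}"

text \<open>
  The free abelian group on the modules \<open>P\<close>, modulo \<open>[P] = [P'] + [P'']\<close> whenever
  \<open>P \<cong> P' \<oplus> P''\<close>. Taking \<open>P'' = 0\<close> shows that isomorphic modules are identified.
\<close>

definition K0_relations :: "('r, 'c) ring_scheme \<Rightarrow> (('r, nat \<Rightarrow> 'r) module \<Rightarrow>\<^sub>0 int) set"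
  where "K0_relations R =
    {frag_of P - (frag_of P' + frag_of P'') | P P' P''.
      P \<in> fg_projectives R \<and> P' \<in> fg_projectives R \<and> P'' \<in> fg_projectives R \<and>
      module_isomorphic R P (direct_sum P' P'')}"

definition K0 :: "('r, 'c) ring_scheme \<Rightarrow> (('r, nat \<Rightarrow> 'r) module \<Rightarrow>\<^sub>0 int) set monoid"
  where "K0 R =
    free_Abelian_group (fg_projectives R) Mod
      generate (free_Abelian_group (fg_projectives R)) (K0_relations R)"

end

theory Submission
  imports Defs
begin

text \<open>
  A trace \<open>\<tau>\<close> on \<open>R\<close> induces the Hattori-Stallings rank on \<open>K\<^sub>0(R)\<close>, sending a module with dual
  basis \<open>(x\<^sub>i, f\<^sub>i)\<close> to the sum of the \<open>\<tau> (f\<^sub>i x\<^sub>i)\<close>, and the module \<open>R e\<close> of an idempotent to \<open>\<tau> e\<close>.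
  If \<open>\<Gamma>\<close> has torsion, it has a finite subgroup \<open>H\<close> of order \<open>n > 1\<close>; let \<open>e\<close> be the average of the
  elements of \<open>H\<close>. The ranks of the two traces \<open>f \<mapsto> f 1\<close> and the augmentation take the values
  \<open>(1 / n, 1)\<close> on \<open>[R e]\<close> and \<open>(1, 1)\<close> on \<open>[R]\<close>. So these two classes are linearly independent over
  the integers, which is impossible in an infinite cyclic group.
\<close>

section \<open>Dual bases\<close>

lemma additive_zero:
  assumes "abelian_group M" "abelian_group N" and h: "h \<in> carrier M \<rightarrow> carrier N"
    and add: "\<And>x y. \<lbrakk>x \<in> carrier M; y \<in> carrier M\<rbrakk> \<Longrightarrow> h (x \<oplus>\<^bsub>M\<^esub> y) = h x \<oplus>\<^bsub>N\<^esub> h y"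
  shows "h \<zero>\<^bsub>M\<^esub> = \<zero>\<^bsub>N\<^esub>"
proof -
  interpret M: abelian_group M by fact
  interpret N: abelian_group N by fact
  have "h \<zero>\<^bsub>M\<^esub> \<in> carrier N" using h by auto
  moreover have "h \<zero>\<^bsub>M\<^esub> \<oplus>\<^bsub>N\<^esub> h \<zero>\<^bsub>M\<^esub> = h \<zero>\<^bsub>M\<^esub>" using add[of "\<zero>\<^bsub>M\<^esub>" "\<zero>\<^bsub>M\<^esub>"] by simp
  ultimately show ?thesis by (metis N.add.l_cancel_one')
qed

lemma (in left_module) smult_zero:
  assumes "a \<in> carrier R"
  shows "a \<odot>\<^bsub>M\<^esub> \<zero>\<^bsub>M\<^esub> = \<zero>\<^bsub>M\<^esub>"
  by (rule additive_zero[where h = "\<lambda>x. a \<odot>\<^bsub>M\<^esub> x"])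
    (use assms in \<open>auto simp: smult_closed smult_r_distr M.abelian_group_axioms\<close>)

text \<open>Only additivity of \<open>h\<close> is asked for, so that the same lemma serves module
  maps, functionals, inclusions and projections of direct sums, and evaluation at a coordinate. For
  infinite \<open>A\<close> both sums are zero by convention, and there \<open>additive_zero\<close>
  closes the gap.\<close>

lemma additive_finsum:
  assumes M: "abelian_group M" and N: "abelian_group N" and h: "h \<in> carrier M \<rightarrow> carrier N"
    and add: "\<And>x y. \<lbrakk>x \<in> carrier M; y \<in> carrier M\<rbrakk> \<Longrightarrow> h (x \<oplus>\<^bsub>M\<^esub> y) = h x \<oplus>\<^bsub>N\<^esub> h y"
    and g: "g \<in> A \<rightarrow> carrier M"
  shows "h (finsum M g A) = finsum N (\<lambda>a. h (g a)) A"
proof -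
  interpret M: abelian_group M by fact
  interpret N: abelian_group N by fact
  note zero = additive_zero[OF M N h add]
  show ?thesis using g
  proof (induction A rule: infinite_finite_induct)
    case (insert a A)
    then have "g \<in> A \<rightarrow> carrier M" "g a \<in> carrier M" by auto
    moreover from this have "(\<lambda>a. h (g a)) \<in> A \<rightarrow> carrier N" "h (g a) \<in> carrier N" using h by auto
    ultimately show ?case
      using insert by (simp add: M.finsum_insert N.finsum_insert add M.finsum_closed)
  qed (simp_all add: zero)
qed

definition linear_functional ::
    "('r, 'c) ring_scheme \<Rightarrow> ('r, 'm, 'd) module_scheme \<Rightarrow> ('m \<Rightarrow> 'r) \<Rightarrow> bool"
  where "linear_functional R M f \<longleftrightarrow> f \<in> carrier M \<rightarrow> carrier R \<and>
    (\<forall>x\<in>carrier M. \<forall>y\<in>carrier M. f (x \<oplus>\<^bsub>M\<^esub> y) = f x \<oplus>\<^bsub>R\<^esub> f y) \<and>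
    (\<forall>a\<in>carrier R. \<forall>x\<in>carrier M. f (a \<odot>\<^bsub>M\<^esub> x) = a \<otimes>\<^bsub>R\<^esub> f x)"

text \<open>The finite form of the data in the dual basis lemma, which describes finitely generated
  projective modules. The type of indices is left free: disjoint sums, subsets of the module and the
  unit type all occur as index sets below.\<close>

definition dual_basis ::
    "('r, 'c) ring_scheme \<Rightarrow> ('r, 'm, 'd) module_scheme \<Rightarrow> 'i set \<Rightarrow> ('i \<Rightarrow> 'm) \<Rightarrow> ('i \<Rightarrow> 'm \<Rightarrow> 'r) \<Rightarrow> bool"
  where "dual_basis R M I x f \<longleftrightarrow> finite I \<and> x \<in> I \<rightarrow> carrier M \<and>
    (\<forall>i\<in>I. linear_functional R M (f i)) \<and>
    (\<forall>m\<in>carrier M. m = (\<Oplus>\<^bsub>M\<^esub>i\<in>I. f i m \<odot>\<^bsub>M\<^esub> x i))"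

lemma linear_functional_finsum:
  assumes "left_module R M" "linear_functional R M f" "c \<in> I \<rightarrow> carrier R" "x \<in> I \<rightarrow> carrier M"
  shows "f (\<Oplus>\<^bsub>M\<^esub>i\<in>I. c i \<odot>\<^bsub>M\<^esub> x i) = (\<Oplus>\<^bsub>R\<^esub>i\<in>I. c i \<otimes>\<^bsub>R\<^esub> f (x i))"
proof -
  interpret left_module R M by fact
  have "f (\<Oplus>\<^bsub>M\<^esub>i\<in>I. c i \<odot>\<^bsub>M\<^esub> x i) = (\<Oplus>\<^bsub>R\<^esub>i\<in>I. f (c i \<odot>\<^bsub>M\<^esub> x i))"
    using assms by (intro additive_finsum M.abelian_group_axioms R.abelian_group_axioms)
      (auto simp: linear_functional_def smult_closed Pi_iff)
  also have "\<dots> = (\<Oplus>\<^bsub>R\<^esub>i\<in>I. c i \<otimes>\<^bsub>R\<^esub> f (x i))"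
    using assms by (intro R.finsum_cong') (auto simp: linear_functional_def Pi_iff)
  finally show ?thesis .
qed

section \<open>The Hattori-Stallings rank\<close>

text \<open>The values only have to be added, subtracted and multiplied by integers, and the trace
  itself only has to be additive; no linearity over the complex numbers enters.\<close>

locale ring_trace = ring R for R :: "('r, 'c) ring_scheme" +
  fixes \<tau> :: "'r \<Rightarrow> 'k::comm_ring_1"
  assumes trace_add: "\<lbrakk>a \<in> carrier R; b \<in> carrier R\<rbrakk> \<Longrightarrow> \<tau> (a \<oplus>\<^bsub>R\<^esub> b) = \<tau> a + \<tau> b"
    and trace_comm: "\<lbrakk>a \<in> carrier R; b \<in> carrier R\<rbrakk> \<Longrightarrow> \<tau> (a \<otimes>\<^bsub>R\<^esub> b) = \<tau> (b \<otimes>\<^bsub>R\<^esub> a)"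
begin

lemma trace_finsum:
  assumes "g \<in> A \<rightarrow> carrier R"
  shows "\<tau> (finsum R g A) = (\<Sum>a\<in>A. \<tau> (g a))"
proof -
  have zero: "\<tau> \<zero>\<^bsub>R\<^esub> = 0" using trace_add[of "\<zero>\<^bsub>R\<^esub>" "\<zero>\<^bsub>R\<^esub>"] by simp
  show ?thesis using assms
    by (induction A rule: infinite_finite_induct)
      (simp_all add: zero finsum_insert trace_add finsum_closed Pi_iff)
qed

text \<open>
  Expanding each basis in the other turns both sides into double sums, of \<open>\<tau> (g\<^sub>j x\<^sub>i \<cdot> f\<^sub>i y\<^sub>j)\<close> and of
  \<open>\<tau> (f\<^sub>i y\<^sub>j \<cdot> g\<^sub>j x\<^sub>i)\<close>.
\<close>

lemma dual_basis_trace_unique: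
  fixes I :: "'i set" and J :: "'j set" and M :: "('r, 'm, 'd) module_scheme"
  assumes M: "left_module R M" and I: "dual_basis R M I x f" and J: "dual_basis R M J y g"
  shows "(\<Sum>i\<in>I. \<tau> (f i (x i))) = (\<Sum>j\<in>J. \<tau> (g j (y j)))"
proof -
  have x: "x i \<in> carrier M" and f: "linear_functional R M (f i)" if "i \<in> I" for i
    using I that by (auto simp: dual_basis_def)
  have y: "y j \<in> carrier M" and g: "linear_functional R M (g j)" if "j \<in> J" for j
    using J that by (auto simp: dual_basis_def)
  have fc: "f i m \<in> carrier R" if "i \<in> I" "m \<in> carrier M" for i m
    using f[OF that(1)] that(2) by (auto simp: linear_functional_def)
  have gc: "g j m \<in> carrier R" if "j \<in> J" "m \<in> carrier M" for j m
    using g[OF that(1)] that(2) by (auto simp: linear_functional_def)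
  have exI: "m = (\<Oplus>\<^bsub>M\<^esub>i\<in>I. f i m \<odot>\<^bsub>M\<^esub> x i)" if "m \<in> carrier M" for m
    using I that by (simp add: dual_basis_def)
  have exJ: "m = (\<Oplus>\<^bsub>M\<^esub>j\<in>J. g j m \<odot>\<^bsub>M\<^esub> y j)" if "m \<in> carrier M" for m
    using J that by (simp add: dual_basis_def)
  have "\<tau> (f i (x i)) = (\<Sum>j\<in>J. \<tau> (g j (x i) \<otimes>\<^bsub>R\<^esub> f i (y j)))" if i: "i \<in> I" for i
  proof -
    have "f i (x i) = f i (\<Oplus>\<^bsub>M\<^esub>j\<in>J. g j (x i) \<odot>\<^bsub>M\<^esub> y j)"
      using exJ[OF x[OF i]] by (rule arg_cong)
    also have "\<dots> = (\<Oplus>\<^bsub>R\<^esub>j\<in>J. g j (x i) \<otimes>\<^bsub>R\<^esub> f i (y j))"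
      by (rule linear_functional_finsum[OF M f[OF i]]) (auto simp: x y gc i)
    finally show ?thesis by (simp add: trace_finsum x y gc fc i Pi_iff)
  qed
  moreover have "\<tau> (g j (y j)) = (\<Sum>i\<in>I. \<tau> (f i (y j) \<otimes>\<^bsub>R\<^esub> g j (x i)))" if j: "j \<in> J" for j
  proof -
    have "g j (y j) = g j (\<Oplus>\<^bsub>M\<^esub>i\<in>I. f i (y j) \<odot>\<^bsub>M\<^esub> x i)"
      using exI[OF y[OF j]] by (rule arg_cong)
    also have "\<dots> = (\<Oplus>\<^bsub>R\<^esub>i\<in>I. f i (y j) \<otimes>\<^bsub>R\<^esub> g j (x i))"
      by (rule linear_functional_finsum[OF M g[OF j]]) (auto simp: x y fc j)
    finally show ?thesis by (simp add: trace_finsum x y gc fc j Pi_iff)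
  qed
  ultimately have "(\<Sum>i\<in>I. \<tau> (f i (x i))) = (\<Sum>i\<in>I. \<Sum>j\<in>J. \<tau> (g j (x i) \<otimes>\<^bsub>R\<^esub> f i (y j)))"
    and "(\<Sum>j\<in>J. \<tau> (g j (y j))) = (\<Sum>j\<in>J. \<Sum>i\<in>I. \<tau> (f i (y j) \<otimes>\<^bsub>R\<^esub> g j (x i)))"
    by simp_all
  moreover have "(\<Sum>i\<in>I. \<Sum>j\<in>J. \<tau> (g j (x i) \<otimes>\<^bsub>R\<^esub> f i (y j))) =
      (\<Sum>j\<in>J. \<Sum>i\<in>I. \<tau> (f i (y j) \<otimes>\<^bsub>R\<^esub> g j (x i)))"
    by (subst sum.swap) (intro sum.cong refl trace_comm; simp add: x y fc gc)
  ultimately show ?thesis by simp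
qed

end

section \<open>Transport of dual bases along isomorphisms and direct sums\<close>

text \<open>The basis is pulled back: elements through the inverse of \<open>\<phi>\<close>,
  functionals by composition with \<open>\<phi>\<close>. This direction fits the defining relations
  of \<open>K0\<close>, where the known dual basis lives on the direct sum at the target of the
  isomorphism.\<close>

lemma dual_basis_iso:
  assumes M: "left_module R M" and N: "left_module R N" and J: "dual_basis R N J y g"
    and bij: "bij_betw \<phi> (carrier M) (carrier N)"
    and add: "\<And>x y. \<lbrakk>x \<in> carrier M; y \<in> carrier M\<rbrakk> \<Longrightarrow> \<phi> (x \<oplus>\<^bsub>M\<^esub> y) = \<phi> x \<oplus>\<^bsub>N\<^esub> \<phi> y"
    and smult: "\<And>a x. \<lbrakk>a \<in> carrier R; x \<in> carrier M\<rbrakk> \<Longrightarrow> \<phi> (a \<odot>\<^bsub>M\<^esub> x) = a \<odot>\<^bsub>N\<^esub> \<phi> x"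
  shows "dual_basis R M J (\<lambda>j. inv_into (carrier M) \<phi> (y j)) (\<lambda>j m. g j (\<phi> m))"
proof -
  interpret M: left_module R M by fact
  interpret N: left_module R N by fact
  define \<psi> where "\<psi> = inv_into (carrier M) \<phi>"
  have \<phi>c: "\<phi> m \<in> carrier N" if "m \<in> carrier M" for m
    using bij that by (auto simp: bij_betw_def)
  have \<psi>c: "\<psi> n \<in> carrier M" and \<phi>\<psi>: "\<phi> (\<psi> n) = n" if "n \<in> carrier N" for n
    using bij that by (auto simp: \<psi>_def bij_betw_def f_inv_into_f inv_into_into)
  have yc: "y j \<in> carrier N" and lin: "linear_functional R N (g j)" if "j \<in> J" for j
    using J that by (auto simp: dual_basis_def)
  have gc: "g j n \<in> carrier R" if "j \<in> J" "n \<in> carrier N" for j n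
    using lin[OF that(1)] that(2) by (auto simp: linear_functional_def)
  have ex: "m = (\<Oplus>\<^bsub>M\<^esub>j\<in>J. g j (\<phi> m) \<odot>\<^bsub>M\<^esub> \<psi> (y j))" (is "_ = ?s") if m: "m \<in> carrier M" for m
  proof -
    \<comment> \<open>By injectivity of \<open>\<phi>\<close> it is enough to compare images in
      \<open>N\<close>, where \<open>J\<close> is already a dual basis.\<close>
    have "\<phi> ?s = (\<Oplus>\<^bsub>N\<^esub>j\<in>J. \<phi> (g j (\<phi> m) \<odot>\<^bsub>M\<^esub> \<psi> (y j)))"
      using m by (intro additive_finsum M.M.abelian_group_axioms N.M.abelian_group_axioms add)
        (auto simp: \<phi>c \<psi>c yc gc M.smult_closed)
    also have "\<dots> = (\<Oplus>\<^bsub>N\<^esub>j\<in>J. g j (\<phi> m) \<odot>\<^bsub>N\<^esub> y j)"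
      using m by (intro N.M.finsum_cong') (auto simp: smult \<phi>\<psi> \<psi>c \<phi>c yc gc N.smult_closed)
    also have "\<dots> = \<phi> m"
      using J \<phi>c[OF m] by (simp add: dual_basis_def)
    finally show ?thesis
      using bij m by (auto simp: bij_betw_def inj_on_def \<psi>c \<phi>c yc gc M.smult_closed intro!: M.M.finsum_closed)
  qed
  have "linear_functional R M (\<lambda>m. g j (\<phi> m))" if "j \<in> J" for j
    using lin[OF that] by (auto simp: linear_functional_def \<phi>c add smult)
  then show ?thesis
    using J \<psi>c yc ex unfolding dual_basis_def \<psi>_def[symmetric]
    by (intro conjI ballI Pi_I) auto
qed

lemma abelian_group_direct_sum:
  assumes "abelian_group M" "abelian_group N"
  shows "abelian_group (direct_sum M N)"
proof -
  interpret M: abelian_group M by fact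
  interpret N: abelian_group N by fact
  show ?thesis
  proof (rule abelian_groupI)
    fix x assume "x \<in> carrier (direct_sum M N)"
    then show "\<exists>y\<in>carrier (direct_sum M N). y \<oplus>\<^bsub>direct_sum M N\<^esub> x = \<zero>\<^bsub>direct_sum M N\<^esub>"
      by (intro bexI[of _ "(\<ominus>\<^bsub>M\<^esub> fst x, \<ominus>\<^bsub>N\<^esub> snd x)"]) (auto simp: direct_sum_def M.l_neg N.l_neg)
  qed (auto simp: direct_sum_def M.a_ac N.a_ac)
qed

lemma left_module_direct_sum:
  assumes "left_module R M" "left_module R N"
  shows "left_module R (direct_sum M N)"
proof -
  interpret M: left_module R M by fact
  interpret N: left_module R N by fact
  show ?thesis
    by (intro left_module.intro M.R.ring_axioms left_module_axioms.intro
        abelian_group_direct_sum M.M.abelian_group_axioms N.M.abelian_group_axioms)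
      (auto simp: direct_sum_def M.smult_closed N.smult_closed M.smult_l_distr N.smult_l_distr
        M.smult_r_distr N.smult_r_distr M.smult_assoc N.smult_assoc M.smult_one N.smult_one)
qed

text \<open>Each functional sees only the component that its own basis element lives in. Hence the
  sum of the diagonal values splits over \<open>I <+> J\<close> into the sums for \<open>M\<close>
  and \<open>N\<close>, which is what makes the rank additive.\<close>

lemma dual_basis_direct_sum:
  assumes M: "left_module R M" and N: "left_module R N"
    and I: "dual_basis R M I x f" and J: "dual_basis R N J y g"
  shows "dual_basis R (direct_sum M N) (I <+> J)
    (case_sum (\<lambda>i. (x i, \<zero>\<^bsub>N\<^esub>)) (\<lambda>j. (\<zero>\<^bsub>M\<^esub>, y j)))
    (case_sum (\<lambda>i m. f i (fst m)) (\<lambda>j m. g j (snd m)))" (is "dual_basis R ?D _ ?z ?h")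
proof -
  interpret M: left_module R M by fact
  interpret N: left_module R N by fact
  interpret D: left_module R ?D by (rule left_module_direct_sum) fact+
  have fin: "finite I" "finite J" using I J by (auto simp: dual_basis_def)
  have x: "x i \<in> carrier M" and f: "linear_functional R M (f i)" if "i \<in> I" for i
    using I that by (auto simp: dual_basis_def)
  have y: "y j \<in> carrier N" and g: "linear_functional R N (g j)" if "j \<in> J" for j
    using J that by (auto simp: dual_basis_def)
  have fc: "f i m \<in> carrier R" if "i \<in> I" "m \<in> carrier M" for i m
    using f[OF that(1)] that(2) by (auto simp: linear_functional_def)
  have gc: "g j m \<in> carrier R" if "j \<in> J" "m \<in> carrier N" for j m
    using g[OF that(1)] that(2) by (auto simp: linear_functional_def)
  have smult_zero: "a \<odot>\<^bsub>M\<^esub> \<zero>\<^bsub>M\<^esub> = \<zero>\<^bsub>M\<^esub>" "a \<odot>\<^bsub>N\<^esub> \<zero>\<^bsub>N\<^esub> = \<zero>\<^bsub>N\<^esub>" if "a \<in> carrier R" for a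
    using that by (rule M.smult_zero N.smult_zero)+
  have zc: "?z k \<in> carrier ?D" if "k \<in> I <+> J" for k
    using that x y by (auto simp: direct_sum_def)
  have lin: "linear_functional R ?D (?h k)" if "k \<in> I <+> J" for k
  proof (cases k)
    case (Inl i)
    with that have "linear_functional R M (f i)" by (auto intro: f)
    then show ?thesis by (auto simp: Inl direct_sum_def linear_functional_def)
  next
    case (Inr j)
    with that have "linear_functional R N (g j)" by (auto intro: g)
    then show ?thesis by (auto simp: Inr direct_sum_def linear_functional_def)
  qed
  have hc: "?h k m \<in> carrier R" if "k \<in> I <+> J" "m \<in> carrier ?D" for k m
    using lin[OF that(1)] that(2) by (auto simp: linear_functional_def)
  have "m = (\<Oplus>\<^bsub>?D\<^esub>k\<in>I <+> J. ?h k m \<odot>\<^bsub>?D\<^esub> ?z k)" (is "_ = ?s") if "m \<in> carrier ?D" for m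
  proof -
    obtain a b where m: "m = (a, b)" and ab: "a \<in> carrier M" "b \<in> carrier N"
      using \<open>m \<in> carrier ?D\<close> by (auto simp: direct_sum_def)
    let ?u = "\<lambda>k. ?h k m \<odot>\<^bsub>?D\<^esub> ?z k"
    have uc: "?u \<in> I <+> J \<rightarrow> carrier ?D"
      using \<open>m \<in> carrier ?D\<close> zc hc by (intro Pi_I D.smult_closed)
    \<comment> \<open>The sum is cut into its \<open>Inl\<close> and \<open>Inr\<close> blocks. Each
      block is the image, under the inclusion of one summand, of the expansion of that component of
      \<open>m\<close>.\<close>
    have "?s = (\<Oplus>\<^bsub>?D\<^esub>k\<in>Inl ` I. ?u k) \<oplus>\<^bsub>?D\<^esub> (\<Oplus>\<^bsub>?D\<^esub>k\<in>Inr ` J. ?u k)"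
      unfolding Plus_def using fin uc by (intro D.M.finsum_Un_disjoint) auto
    also have "(\<Oplus>\<^bsub>?D\<^esub>k\<in>Inl ` I. ?u k) = (\<Oplus>\<^bsub>?D\<^esub>i\<in>I. (f i a \<odot>\<^bsub>M\<^esub> x i, \<zero>\<^bsub>N\<^esub>))"
    proof (subst D.M.finsum_reindex)
      show "(\<Oplus>\<^bsub>?D\<^esub>i\<in>I. ?u (Inl i)) = (\<Oplus>\<^bsub>?D\<^esub>i\<in>I. (f i a \<odot>\<^bsub>M\<^esub> x i, \<zero>\<^bsub>N\<^esub>))"
        by (intro D.M.finsum_cong' refl)
          (auto simp: m direct_sum_def smult_zero fc ab x M.smult_closed)
    qed (use uc in auto)
    also have "\<dots> = (\<Oplus>\<^bsub>M\<^esub>i\<in>I. f i a \<odot>\<^bsub>M\<^esub> x i, \<zero>\<^bsub>N\<^esub>)"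
      by (rule additive_finsum[where h="\<lambda>m. (m, \<zero>\<^bsub>N\<^esub>)", symmetric])
        (auto simp: direct_sum_def fc ab x M.smult_closed intro: M.M.abelian_group_axioms D.M.abelian_group_axioms[unfolded direct_sum_def])
    also have "(\<Oplus>\<^bsub>M\<^esub>i\<in>I. f i a \<odot>\<^bsub>M\<^esub> x i) = a" using I ab unfolding dual_basis_def by metis
    also have "(\<Oplus>\<^bsub>?D\<^esub>k\<in>Inr ` J. ?u k) = (\<Oplus>\<^bsub>?D\<^esub>j\<in>J. (\<zero>\<^bsub>M\<^esub>, g j b \<odot>\<^bsub>N\<^esub> y j))"
    proof (subst D.M.finsum_reindex)
      show "(\<Oplus>\<^bsub>?D\<^esub>j\<in>J. ?u (Inr j)) = (\<Oplus>\<^bsub>?D\<^esub>j\<in>J. (\<zero>\<^bsub>M\<^esub>, g j b \<odot>\<^bsub>N\<^esub> y j))"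
        by (intro D.M.finsum_cong' refl)
          (auto simp: m direct_sum_def smult_zero gc ab y N.smult_closed)
    qed (use uc in auto)
    also have "\<dots> = (\<zero>\<^bsub>M\<^esub>, \<Oplus>\<^bsub>N\<^esub>j\<in>J. g j b \<odot>\<^bsub>N\<^esub> y j)"
      by (rule additive_finsum[where h="\<lambda>m. (\<zero>\<^bsub>M\<^esub>, m)", symmetric])
        (auto simp: direct_sum_def gc ab y N.smult_closed intro: N.M.abelian_group_axioms D.M.abelian_group_axioms[unfolded direct_sum_def])
    also have "(\<Oplus>\<^bsub>N\<^esub>j\<in>J. g j b \<odot>\<^bsub>N\<^esub> y j) = b" using J ab unfolding dual_basis_def by metis
    finally show ?thesis using ab by (simp add: m direct_sum_def)
  qed
  then show ?thesis
    unfolding dual_basis_def by (intro conjI ballI Pi_I finite_Plus fin zc lin)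
qed

section \<open>Free modules and the existence of dual bases\<close>

lemma left_module_free_module:
  assumes "ring R"
  shows "left_module R (free_module R I)"
proof -
  interpret ring R by fact
  let ?F = "free_module R I"
  have fsub: "finite {i. u i \<noteq> \<zero>\<^bsub>R\<^esub>} \<and> {i. u i \<noteq> \<zero>\<^bsub>R\<^esub>} \<subseteq> I"
    if "finite A" "A \<subseteq> I" "{i. u i \<noteq> \<zero>\<^bsub>R\<^esub>} \<subseteq> A" for u A
    using that by (blast intro: finite_subset)
  have closed: "(\<lambda>i. v i \<oplus>\<^bsub>R\<^esub> w i) \<in> carrier ?F" if "v \<in> carrier ?F" "w \<in> carrier ?F" for v w
  proof -
    have "{i. v i \<oplus>\<^bsub>R\<^esub> w i \<noteq> \<zero>\<^bsub>R\<^esub>} \<subseteq> {i. v i \<noteq> \<zero>\<^bsub>R\<^esub>} \<union> {i. w i \<noteq> \<zero>\<^bsub>R\<^esub>}"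
      by auto
    from fsub[OF _ _ this] show ?thesis using that by (simp add: free_module_def)
  qed
  have neg: "(\<lambda>i. \<ominus>\<^bsub>R\<^esub> v i) \<in> carrier ?F" if "v \<in> carrier ?F" for v
  proof -
    have "{i. \<ominus>\<^bsub>R\<^esub> v i \<noteq> \<zero>\<^bsub>R\<^esub>} \<subseteq> {i. v i \<noteq> \<zero>\<^bsub>R\<^esub>}" by auto
    from fsub[OF _ _ this] show ?thesis using that by (simp add: free_module_def)
  qed
  have sm: "(\<lambda>i. a \<otimes>\<^bsub>R\<^esub> v i) \<in> carrier ?F" if "a \<in> carrier R" "v \<in> carrier ?F" for a v
  proof -
    have "{i. a \<otimes>\<^bsub>R\<^esub> v i \<noteq> \<zero>\<^bsub>R\<^esub>} \<subseteq> {i. v i \<noteq> \<zero>\<^bsub>R\<^esub>}" using that by auto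
    from fsub[OF _ _ this] show ?thesis using that by (simp add: free_module_def)
  qed
  have "abelian_group ?F"
  proof (rule abelian_groupI)
    fix v assume "v \<in> carrier ?F"
    then show "\<exists>y\<in>carrier ?F. y \<oplus>\<^bsub>?F\<^esub> v = \<zero>\<^bsub>?F\<^esub>"
      using neg[of v] by (intro bexI[of _ "\<lambda>i. \<ominus>\<^bsub>R\<^esub> v i"]) (auto simp: free_module_def l_neg)
  qed (use closed in \<open>auto simp: free_module_def a_ac\<close>)
  then show ?thesis
    using sm by (intro left_module.intro left_module_axioms.intro ring_axioms)
      (auto simp: free_module_def l_distr r_distr m_assoc)
qed

lemma finsum_free_module_apply:
  assumes "ring R" "g \<in> A \<rightarrow> carrier (free_module R I)"
  shows "(finsum (free_module R I) g A) k = (\<Oplus>\<^bsub>R\<^esub>a\<in>A. g a k)"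
proof -
  interpret ring R by fact
  interpret F: left_module R "free_module R I" by (rule left_module_free_module) fact
  show ?thesis
    by (rule additive_finsum[where h="\<lambda>v. v k"])
      (use assms F.M.abelian_group_axioms in \<open>auto simp: free_module_def abelian_group_axioms\<close>)
qed

text \<open>The index set \<open>I\<close> may be infinite, whereas a dual basis has to be finite.
  The images of finitely many generators have finite supports, and a linear combination of them
  vanishes outside the union of these supports.\<close>

lemma finitely_generated_support:
  assumes M: "left_module R M" and fg: "finitely_generated R M"
    and h: "h \<in> carrier M \<rightarrow> carrier (free_module R I)"
    and add: "\<And>x y. \<lbrakk>x \<in> carrier M; y \<in> carrier M\<rbrakk> \<Longrightarrow> h (x \<oplus>\<^bsub>M\<^esub> y) = h x \<oplus>\<^bsub>free_module R I\<^esub> h y"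
    and smult: "\<And>a x. \<lbrakk>a \<in> carrier R; x \<in> carrier M\<rbrakk> \<Longrightarrow> h (a \<odot>\<^bsub>M\<^esub> x) = a \<odot>\<^bsub>free_module R I\<^esub> h x"
  obtains J where "finite J" "J \<subseteq> I" "\<And>x i. \<lbrakk>x \<in> carrier M; i \<notin> J\<rbrakk> \<Longrightarrow> h x i = \<zero>\<^bsub>R\<^esub>"
proof -
  interpret M: left_module R M by fact
  let ?F = "free_module R I"
  interpret F: left_module R ?F by (rule left_module_free_module) (rule M.R.ring_axioms)
  obtain A where A: "finite A" "A \<subseteq> carrier M"
    and gen: "\<And>x. x \<in> carrier M \<Longrightarrow> \<exists>c\<in>A \<rightarrow> carrier R. x = (\<Oplus>\<^bsub>M\<^esub>a\<in>A. c a \<odot>\<^bsub>M\<^esub> a)"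
    using fg by (auto simp: finitely_generated_def)
  define J where "J = (\<Union>a\<in>A. {i. h a i \<noteq> \<zero>\<^bsub>R\<^esub>})"
  have hF: "h a \<in> carrier ?F" if "a \<in> A" for a using h A that by auto
  have "finite J" "J \<subseteq> I"
    using A hF by (auto simp: J_def free_module_def)
  moreover have "h x i = \<zero>\<^bsub>R\<^esub>" if x: "x \<in> carrier M" and i: "i \<notin> J" for x i
  proof -
    obtain c where c: "c \<in> A \<rightarrow> carrier R" and xc: "x = (\<Oplus>\<^bsub>M\<^esub>a\<in>A. c a \<odot>\<^bsub>M\<^esub> a)"
      using gen[OF x] by auto
    have "h x = (\<Oplus>\<^bsub>?F\<^esub>a\<in>A. h (c a \<odot>\<^bsub>M\<^esub> a))"
      unfolding xc using c A
      by (intro additive_finsum h add M.M.abelian_group_axioms F.M.abelian_group_axioms)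
        (auto intro!: M.smult_closed)
    then have "h x i = (\<Oplus>\<^bsub>R\<^esub>a\<in>A. h (c a \<odot>\<^bsub>M\<^esub> a) i)"
      using c A h by (simp add: finsum_free_module_apply[OF M.R.ring_axioms] Pi_iff M.smult_closed subset_iff)
    also have "\<dots> = (\<Oplus>\<^bsub>R\<^esub>a\<in>A. \<zero>\<^bsub>R\<^esub>)"
    proof (intro M.R.finsum_cong' refl)
      fix a assume a: "a \<in> A"
      then have "h a i = \<zero>\<^bsub>R\<^esub>" using i by (auto simp: J_def)
      moreover have "c a \<in> carrier R" "a \<in> carrier M" using a c A by auto
      ultimately show "h (c a \<odot>\<^bsub>M\<^esub> a) i = \<zero>\<^bsub>R\<^esub>"
        by (simp add: smult) (simp add: free_module_def)
    qed auto
    finally show ?thesis by simp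
  qed
  ultimately show ?thesis by (rule that)
qed

text \<open>If \<open>M\<close> is a summand of a free module, the coordinates of the inclusion are
  the functionals and the projections to \<open>M\<close> of the standard basis vectors are the
  elements. Finite generation cuts the index set down to a finite one.\<close>

lemma fg_projective_dual_basis:
  fixes M :: "('r, 'm, 'd) module_scheme"
  assumes M: "left_module R M" and fg: "finitely_generated R M" and proj: "projective R M"
  shows "\<exists>(I :: 'm set) x f. dual_basis R M I x f"
proof -
  interpret M: left_module R M by fact
  obtain I :: "'m set" and N :: "('r, 'm \<Rightarrow> 'r) module" and \<phi> where N: "left_module R N"
    and bij: "bij_betw \<phi> (carrier (direct_sum M N)) (carrier (free_module R I))"
    and add: "\<And>x y. \<lbrakk>x \<in> carrier (direct_sum M N); y \<in> carrier (direct_sum M N)\<rbrakk> \<Longrightarrow>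
      \<phi> (x \<oplus>\<^bsub>direct_sum M N\<^esub> y) = \<phi> x \<oplus>\<^bsub>free_module R I\<^esub> \<phi> y"
    and smult: "\<And>a x. \<lbrakk>a \<in> carrier R; x \<in> carrier (direct_sum M N)\<rbrakk> \<Longrightarrow>
      \<phi> (a \<odot>\<^bsub>direct_sum M N\<^esub> x) = a \<odot>\<^bsub>free_module R I\<^esub> \<phi> x"
    using proj unfolding projective_def module_isomorphic_def by auto
  let ?F = "free_module R I" and ?D = "direct_sum M N"
  interpret N: left_module R N by fact
  interpret F: left_module R ?F by (rule left_module_free_module) (rule M.R.ring_axioms)
  interpret D: left_module R ?D by (rule left_module_direct_sum) fact+
  have smult_zero: "a \<odot>\<^bsub>N\<^esub> \<zero>\<^bsub>N\<^esub> = \<zero>\<^bsub>N\<^esub>" if "a \<in> carrier R" for a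
    using that by (rule N.smult_zero)
  \<comment> \<open>The inclusion of \<open>M\<close> into the free module.\<close>
  define s where "s m = \<phi> (m, \<zero>\<^bsub>N\<^esub>)" for m
  have inc: "(m, \<zero>\<^bsub>N\<^esub>) \<in> carrier ?D" if "m \<in> carrier M" for m
    using that by (simp add: direct_sum_def)
  have sc: "s \<in> carrier M \<rightarrow> carrier ?F"
    using bij inc by (auto simp: s_def bij_betw_def)
  have sadd: "s (x \<oplus>\<^bsub>M\<^esub> y) = s x \<oplus>\<^bsub>?F\<^esub> s y" if "x \<in> carrier M" "y \<in> carrier M" for x y
    using add[OF inc inc, OF that] by (simp add: s_def direct_sum_def)
  have ssm: "s (a \<odot>\<^bsub>M\<^esub> x) = a \<odot>\<^bsub>?F\<^esub> s x" if "a \<in> carrier R" "x \<in> carrier M" for a x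
    using smult[OF that(1) inc[OF that(2)]] that by (simp add: s_def direct_sum_def smult_zero)
  obtain J where J: "finite J" "J \<subseteq> I" and supp: "\<And>x i. \<lbrakk>x \<in> carrier M; i \<notin> J\<rbrakk> \<Longrightarrow> s x i = \<zero>\<^bsub>R\<^esub>"
    using finitely_generated_support[OF M fg sc sadd ssm] by blast
  \<comment> \<open>The standard basis vectors; with \<open>\<psi>\<close> inverse to
    \<open>\<phi>\<close>, the map \<open>fst\<close> after \<open>\<psi>\<close> is the projection
    of the free module onto \<open>M\<close>.\<close>
  define \<delta> :: "'m \<Rightarrow> 'm \<Rightarrow> 'r" where "\<delta> i = (\<lambda>k. if k = i then \<one>\<^bsub>R\<^esub> else \<zero>\<^bsub>R\<^esub>)" for i
  define \<psi> where "\<psi> = inv_into (carrier ?D) \<phi>"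
  have \<delta>c: "\<delta> i \<in> carrier ?F" if "i \<in> J" for i
    using that J by (auto simp: \<delta>_def free_module_def)
  have sic: "s m i \<in> carrier R" if "m \<in> carrier M" for m i
    using funcset_mem[OF sc that] by (simp add: free_module_def)
  have \<psi>c: "\<psi> v \<in> carrier ?D" and \<phi>\<psi>: "\<phi> (\<psi> v) = v" if "v \<in> carrier ?F" for v
    using bij that by (auto simp: \<psi>_def bij_betw_def f_inv_into_f inv_into_into)
  have fstc: "fst z \<in> carrier M" if "z \<in> carrier ?D" for z
    using that by (auto simp: direct_sum_def)
  have "m = (\<Oplus>\<^bsub>M\<^esub>i\<in>J. s m i \<odot>\<^bsub>M\<^esub> fst (\<psi> (\<delta> i)))" if m: "m \<in> carrier M" for m
  proof -
    have sm: "s m = (\<Oplus>\<^bsub>?F\<^esub>i\<in>J. s m i \<odot>\<^bsub>?F\<^esub> \<delta> i)"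
    proof
      fix k
      have "(\<Oplus>\<^bsub>?F\<^esub>i\<in>J. s m i \<odot>\<^bsub>?F\<^esub> \<delta> i) k = (\<Oplus>\<^bsub>R\<^esub>i\<in>J. (s m i \<odot>\<^bsub>?F\<^esub> \<delta> i) k)"
        by (rule finsum_free_module_apply[OF M.R.ring_axioms])
          (auto simp: F.smult_closed sic m \<delta>c)
      also have "\<dots> = (\<Oplus>\<^bsub>R\<^esub>i\<in>J. if k = i then s m i else \<zero>\<^bsub>R\<^esub>)"
        by (intro M.R.finsum_cong') (auto simp: free_module_def \<delta>_def sic m)
      also have "\<dots> = s m k"
      proof (cases "k \<in> J")
        case True
        then show ?thesis using J sic[OF m] by (subst M.R.finsum_singleton) auto
      next
        case False
        then have "(\<Oplus>\<^bsub>R\<^esub>i\<in>J. if k = i then s m i else \<zero>\<^bsub>R\<^esub>) = (\<Oplus>\<^bsub>R\<^esub>i\<in>J. \<zero>\<^bsub>R\<^esub>)"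
          by (intro M.R.finsum_cong') auto
        then show ?thesis using supp[OF m False] by simp
      qed
      finally show "s m k = (\<Oplus>\<^bsub>?F\<^esub>i\<in>J. s m i \<odot>\<^bsub>?F\<^esub> \<delta> i) k" by simp
    qed
    \<comment> \<open>Linearity is available for \<open>\<phi>\<close> but has not been shown for
      \<open>\<psi>\<close>. So the sum is formed in the direct sum, mapped forward by
      \<open>\<phi>\<close>, and recognised as \<open>(m, 0)\<close> by injectivity.\<close>
    let ?t = "\<Oplus>\<^bsub>?D\<^esub>i\<in>J. s m i \<odot>\<^bsub>?D\<^esub> \<psi> (\<delta> i)"
    have tc: "?t \<in> carrier ?D"
      by (intro D.M.finsum_closed) (auto simp: D.smult_closed sic m \<psi>c \<delta>c)
    have "\<phi> ?t = (\<Oplus>\<^bsub>?F\<^esub>i\<in>J. \<phi> (s m i \<odot>\<^bsub>?D\<^esub> \<psi> (\<delta> i)))"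
      using bij by (intro additive_finsum add F.M.abelian_group_axioms D.M.abelian_group_axioms)
        (auto simp: D.smult_closed sic m \<psi>c \<delta>c bij_betw_def)
    also have "\<dots> = (\<Oplus>\<^bsub>?F\<^esub>i\<in>J. s m i \<odot>\<^bsub>?F\<^esub> \<delta> i)"
      by (intro F.M.finsum_cong') (auto simp: F.smult_closed sic m \<psi>c \<delta>c \<phi>\<psi> smult)
    also have "\<dots> = s m"
      by (rule sm[symmetric])
    finally have "?t = (m, \<zero>\<^bsub>N\<^esub>)"
      using bij tc inc[OF m] by (auto simp: s_def bij_betw_def dest: inj_onD)
    then have "m = fst ?t" by simp
    also have "\<dots> = (\<Oplus>\<^bsub>M\<^esub>i\<in>J. fst (s m i \<odot>\<^bsub>?D\<^esub> \<psi> (\<delta> i)))"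
      by (intro additive_finsum M.M.abelian_group_axioms D.M.abelian_group_axioms)
        (auto simp: D.smult_closed sic m \<psi>c \<delta>c fstc, auto simp: direct_sum_def)
    also have "\<dots> = (\<Oplus>\<^bsub>M\<^esub>i\<in>J. s m i \<odot>\<^bsub>M\<^esub> fst (\<psi> (\<delta> i)))"
      by (intro M.M.finsum_cong')
        (auto simp: M.smult_closed sic m \<psi>c \<delta>c fstc, auto simp: direct_sum_def split_beta)
    finally show ?thesis .
  qed
  moreover have "linear_functional R M (\<lambda>m. s m i)" for i
    using sadd ssm sic by (auto simp: linear_functional_def) (auto simp: free_module_def)
  ultimately have "dual_basis R M J (\<lambda>i. fst (\<psi> (\<delta> i))) (\<lambda>i m. s m i)"
    unfolding dual_basis_def by (intro conjI ballI Pi_I J fstc \<psi>c \<delta>c)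
  then show ?thesis by blast
qed

section \<open>Well-definedness and additivity of the rank\<close>

context ring_trace
begin

text \<open>
  The index type \<open>'m\<close> suffices because \<open>projective\<close> only speaks of free modules on such index sets.
\<close>

definition hs_rank :: "('r, 'm, 'd) module_scheme \<Rightarrow> 'k"
  where "hs_rank M = (THE t. \<exists>(I :: 'm set) x f. dual_basis R M I x f \<and> t = (\<Sum>i\<in>I. \<tau> (f i (x i))))"

text \<open>The definition fixes one index type, but \<open>dual_basis_trace_unique\<close> compares
  dual bases with different index types. Hence any dual basis whatsoever computes the rank.\<close>

lemma hs_rank_eq:
  fixes M :: "('r, 'm, 'd) module_scheme" and J :: "'j set"
  assumes M: "left_module R M" and "finitely_generated R M" "projective R M"
    and J: "dual_basis R M J y g"
  shows "hs_rank M = (\<Sum>j\<in>J. \<tau> (g j (y j)))"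
proof -
  obtain I :: "'m set" and x f where I: "dual_basis R M I x f"
    using fg_projective_dual_basis assms by blast
  show ?thesis
    unfolding hs_rank_def
    by (rule the_equality) (use I dual_basis_trace_unique[OF M _ J] in \<open>metis+\<close>)
qed

text \<open>The combined dual basis of the direct sum is pulled back to \<open>P\<close> along the
  isomorphism and its diagonal values are summed.\<close>

lemma hs_rank_direct_sum:
  assumes P: "P \<in> fg_projectives R" and P': "P' \<in> fg_projectives R" and P'': "P'' \<in> fg_projectives R"
    and iso: "module_isomorphic R P (direct_sum P' P'')"
  shows "hs_rank P = hs_rank P' + hs_rank P''"
proof -
  have lm: "left_module R P" "left_module R P'" "left_module R P''"
    and fg: "finitely_generated R P" "finitely_generated R P'" "finitely_generated R P''"
    and pr: "projective R P" "projective R P'" "projective R P''"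
    using P P' P'' by (auto simp: fg_projectives_def)
  interpret P': left_module R P' by fact
  interpret P'': left_module R P'' by fact
  obtain I :: "(nat \<Rightarrow> 'r) set" and x f where I: "dual_basis R P' I x f"
    using fg_projective_dual_basis lm fg pr by blast
  obtain J :: "(nat \<Rightarrow> 'r) set" and y g where J: "dual_basis R P'' J y g"
    using fg_projective_dual_basis lm fg pr by blast
  let ?D = "direct_sum P' P''"
  let ?z = "case_sum (\<lambda>i. (x i, \<zero>\<^bsub>P''\<^esub>)) (\<lambda>j. (\<zero>\<^bsub>P'\<^esub>, y j))"
  let ?h = "case_sum (\<lambda>i m. f i (fst m)) (\<lambda>j m. g j (snd m))"
  obtain \<phi> where bij: "bij_betw \<phi> (carrier P) (carrier ?D)"
    and add: "\<And>x y. \<lbrakk>x \<in> carrier P; y \<in> carrier P\<rbrakk> \<Longrightarrow> \<phi> (x \<oplus>\<^bsub>P\<^esub> y) = \<phi> x \<oplus>\<^bsub>?D\<^esub> \<phi> y"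
    and smult: "\<And>a x. \<lbrakk>a \<in> carrier R; x \<in> carrier P\<rbrakk> \<Longrightarrow> \<phi> (a \<odot>\<^bsub>P\<^esub> x) = a \<odot>\<^bsub>?D\<^esub> \<phi> x"
    using iso by (auto simp: module_isomorphic_def)
  have D: "dual_basis R ?D (I <+> J) ?z ?h"
    by (rule dual_basis_direct_sum[OF lm(2,3) I J])
  have fin: "finite I" "finite J" using I J by (auto simp: dual_basis_def)
  \<comment> \<open>A pulled-back functional applies \<open>\<phi>\<close> to a pulled-back element,
    so the isomorphism drops out of every diagonal value.\<close>
  have cancel: "\<phi> (inv_into (carrier P) \<phi> (?z k)) = ?z k" if "k \<in> I <+> J" for k
  proof -
    have "?z k \<in> carrier ?D" using D that by (auto simp: dual_basis_def)
    then show ?thesis using f_inv_into_f[of _ \<phi> "carrier P"] bij by (simp add: bij_betw_def)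
  qed
  have "hs_rank P = (\<Sum>k\<in>I <+> J. \<tau> (?h k (\<phi> (inv_into (carrier P) \<phi> (?z k)))))"
    by (intro hs_rank_eq lm(1) fg(1) pr(1)
        dual_basis_iso[OF lm(1) left_module_direct_sum[OF lm(2,3)] D bij] add smult)
  also have "\<dots> = (\<Sum>k\<in>I <+> J. \<tau> (?h k (?z k)))"
    by (intro sum.cong refl) (simp add: cancel)
  also have "\<dots> = (\<Sum>i\<in>I. \<tau> (f i (x i))) + (\<Sum>j\<in>J. \<tau> (g j (y j)))"
    using fin by (simp add: sum.Plus)
  also have "\<dots> = hs_rank P' + hs_rank P''"
    using hs_rank_eq[OF lm(2) fg(2) pr(2) I] hs_rank_eq[OF lm(3) fg(3) pr(3) J] by simp
  finally show ?thesis .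
qed

section \<open>Extension of the rank to formal sums of modules\<close>

text \<open>The additive extension of the rank to the free abelian group. It is kept on
  representatives instead of cosets; \<open>K0_rank_relations\<close> says that it factors through
  the quotient.\<close>

definition K0_rank :: "(('r, nat \<Rightarrow> 'r) module \<Rightarrow>\<^sub>0 int) \<Rightarrow> 'k"
  where "K0_rank c = (\<Sum>P\<in>Poly_Mapping.keys c. of_int (Poly_Mapping.lookup c P) * hs_rank P)"

text \<open>Sums of formal sums may lose keys by cancellation; a common finite superset of the keys
  lets the terms be compared one by one.\<close>

lemma K0_rank_superset:
  assumes "finite S" "Poly_Mapping.keys c \<subseteq> S"
  shows "K0_rank c = (\<Sum>P\<in>S. of_int (Poly_Mapping.lookup c P) * hs_rank P)"
  unfolding K0_rank_def using assms
  by (intro sum.mono_neutral_left) (auto simp: in_keys_iff)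

lemma K0_rank_add: "K0_rank (c + d) = K0_rank c + K0_rank d"
proof -
  let ?S = "Poly_Mapping.keys c \<union> Poly_Mapping.keys d"
  have "K0_rank b = (\<Sum>P\<in>?S. of_int (Poly_Mapping.lookup b P) * hs_rank P)" if "b \<in> {c, d, c + d}" for b
    using that keys_add[of c d] by (intro K0_rank_superset) auto
  then show ?thesis
    by (simp add: lookup_add algebra_simps flip: sum.distrib)
qed

lemma K0_rank_cmul: "K0_rank (frag_cmul n c) = of_int n * K0_rank c"
  using K0_rank_superset[OF finite_keys keys_cmul, of n c]
  by (simp add: K0_rank_def sum_distrib_left mult.assoc)

lemma K0_rank_frag_of [simp]: "K0_rank (frag_of P) = hs_rank P"
  by (simp add: K0_rank_def)

lemma K0_rank_uminus: "K0_rank (- c) = - K0_rank c"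
  using K0_rank_cmul[of "-1" c] by simp

lemma K0_rank_diff: "K0_rank (c - d) = K0_rank c - K0_rank d"
  using K0_rank_add[of "c - d" d] by simp

lemma K0_rank_relations:
  assumes "c \<in> generate (free_Abelian_group (fg_projectives R)) (K0_relations R)"
  shows "K0_rank c = 0"
proof -
  let ?A = "free_Abelian_group (fg_projectives R)"
  have rel: "K0_rank c = 0" if "c \<in> K0_relations R" for c
  proof -
    obtain P P' P'' where "c = frag_of P - (frag_of P' + frag_of P'')"
      and "P \<in> fg_projectives R" "P' \<in> fg_projectives R" "P'' \<in> fg_projectives R"
      and "module_isomorphic R P (direct_sum P' P'')"
      using \<open>c \<in> K0_relations R\<close> unfolding K0_relations_def by blast
    then show ?thesis
      using hs_rank_direct_sum[of P P' P''] by (simp add: K0_rank_diff K0_rank_add)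
  qed
  \<comment> \<open>The group inverse in the free abelian group is negation only for elements whose
    keys lie in its basis, so the inverse rule of \<open>generate\<close> needs this
    inclusion.\<close>
  have sub: "Poly_Mapping.keys c \<subseteq> fg_projectives R" if "c \<in> K0_relations R" for c
    using that by (auto simp: K0_relations_def in_keys_iff lookup_minus lookup_add split: if_splits)
  show ?thesis using assms
  proof induction
    case one
    show ?case by (simp add: K0_rank_def)
  qed (simp_all add: rel sub K0_rank_uminus K0_rank_add)
qed

end

section \<open>Reading off an infinite cyclic \<open>K0\<close>\<close>

lemma K0_relations_subset: "K0_relations R \<subseteq> carrier (free_Abelian_group (fg_projectives R))"
  by (auto simp: K0_relations_def in_keys_iff lookup_minus lookup_add split: if_splits)

text \<open>The isomorphism is pulled back along the quotient map to an additive function on formal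
  sums. Injectivity becomes the statement that its kernel consists of consequences of the relations,
  so later arguments can avoid cosets.\<close>

lemma K0_integer_hom:
  assumes "K0 R \<cong> integer_group"
  obtains \<theta> :: "_ \<Rightarrow> int" where
    "\<And>c n. Poly_Mapping.keys c \<subseteq> fg_projectives R \<Longrightarrow> \<theta> (frag_cmul n c) = n * \<theta> c"
    "\<And>c d. Poly_Mapping.keys c \<subseteq> fg_projectives R \<Longrightarrow> Poly_Mapping.keys d \<subseteq> fg_projectives R \<Longrightarrow>
      \<theta> (c + d) = \<theta> c + \<theta> d"
    "\<And>c. Poly_Mapping.keys c \<subseteq> fg_projectives R \<Longrightarrow> \<theta> c = 0 \<Longrightarrow>
      c \<in> generate (free_Abelian_group (fg_projectives R)) (K0_relations R)"
proof -
  let ?A = "free_Abelian_group (fg_projectives R)"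
  let ?N = "generate ?A (K0_relations R)"
  interpret A: comm_group ?A by (rule abelian_free_Abelian_group)
  have sg: "subgroup ?N ?A" by (rule A.generate_is_subgroup) (rule K0_relations_subset)
  interpret N: normal ?N ?A using sg by (rule A.subgroup_imp_normal)
  obtain \<phi> where \<phi>: "\<phi> \<in> iso (?A Mod ?N) integer_group"
    using assms by (auto simp: K0_def is_iso_def)
  define \<theta> where "\<theta> = (\<lambda>c. \<phi> (?N #>\<^bsub>?A\<^esub> c))"
  have "\<theta> \<in> hom ?A integer_group"
    using hom_compose[OF N.r_coset_hom_Mod Group.iso_imp_homomorphism[OF \<phi>]]
    by (simp add: \<theta>_def comp_def)
  then interpret \<theta>: group_hom ?A integer_group \<theta>
    by (simp add: group_hom_def group_hom_axioms_def A.is_group)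
  have ker: "c \<in> ?N" if c: "c \<in> carrier ?A" and "\<theta> c = 0" for c
  proof -
    have "inj_on \<phi> (carrier (?A Mod ?N))" using \<phi> by (auto simp: iso_def bij_betw_def)
    moreover have "?N #>\<^bsub>?A\<^esub> c \<in> carrier (?A Mod ?N)" "?N #>\<^bsub>?A\<^esub> 0 \<in> carrier (?A Mod ?N)"
      using c by (auto simp: carrier_FactGroup)
    \<comment> \<open>The formal sum \<open>0\<close> is the identity of the free abelian group, so
      an element of the kernel has the same coset as \<open>0\<close>, namely the subgroup
      itself.\<close>
    moreover have "\<theta> 0 = 0" using \<theta>.hom_one by simp
    ultimately have "?N #>\<^bsub>?A\<^esub> c = ?N #>\<^bsub>?A\<^esub> 0"
      using \<open>\<theta> c = 0\<close> unfolding \<theta>_def by (metis inj_onD)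
    also have "\<dots> = ?N" using N.rcos_const[OF A.is_group, of 0] N.one_closed by simp
    finally show ?thesis using A.coset_join1 c sg by blast
  qed
  show ?thesis
  proof (rule that[of \<theta>])
    show "\<theta> (frag_cmul n c) = n * \<theta> c" if "Poly_Mapping.keys c \<subseteq> fg_projectives R" for c n
      using \<theta>.hom_int_pow[of c n] that by simp
    show "\<theta> (c + d) = \<theta> c + \<theta> d"
      if "Poly_Mapping.keys c \<subseteq> fg_projectives R" "Poly_Mapping.keys d \<subseteq> fg_projectives R" for c d
      using \<theta>.hom_mult[of c d] that by simp
  qed (use ker in auto)
qed

section \<open>Modules of idempotents\<close>

text \<open>
  The left ideal \<open>R e\<close>, with its elements stored at position \<open>k\<close> of a function so that the module has
  the type required by \<open>fg_projectives\<close>.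
\<close>

definition idem_module :: "('r, 'c) ring_scheme \<Rightarrow> 'r \<Rightarrow> 'i \<Rightarrow> ('r, 'i \<Rightarrow> 'r) module"
  where "idem_module R e k = (free_module R {k})
    \<lparr>carrier := {v \<in> carrier (free_module R {k}). v k \<otimes>\<^bsub>R\<^esub> e = v k}\<rparr>"

lemma (in ring) free_module_singleton_iff:
  "v \<in> carrier (free_module R {k}) \<longleftrightarrow> v k \<in> carrier R \<and> (\<forall>i. i \<noteq> k \<longrightarrow> v i = \<zero>)"
proof
  assume v: "v k \<in> carrier R \<and> (\<forall>i. i \<noteq> k \<longrightarrow> v i = \<zero>)"
  then have "{i. v i \<noteq> \<zero>} \<subseteq> {k}" by auto
  moreover from this have "finite {i. v i \<noteq> \<zero>}" by (rule finite_subset) simp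
  moreover have "v i \<in> carrier R" for i using v by (cases "i = k") simp_all
  ultimately show "v \<in> carrier (free_module R {k})" by (simp add: free_module_def)
qed (auto simp: free_module_def)

lemma (in ring) left_module_idem_module:
  assumes e: "e \<in> carrier R"
  shows "left_module R (idem_module R e k)"
proof -
  let ?F = "free_module R {k}" and ?P = "idem_module R e k"
  interpret F: left_module R ?F by (rule left_module_free_module) (rule ring_axioms)
  have car: "v \<in> carrier ?P \<longleftrightarrow> v \<in> carrier ?F \<and> v k \<otimes> e = v k" for v
    by (simp add: idem_module_def)
  have op: "v \<oplus>\<^bsub>?P\<^esub> w = v \<oplus>\<^bsub>?F\<^esub> w" "a \<odot>\<^bsub>?P\<^esub> v = a \<odot>\<^bsub>?F\<^esub> v" "\<zero>\<^bsub>?P\<^esub> = \<zero>\<^bsub>?F\<^esub>" for v w a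
    by (simp_all add: idem_module_def)
  have ap: "(v \<oplus>\<^bsub>?F\<^esub> w) i = v i \<oplus> w i" "(a \<odot>\<^bsub>?F\<^esub> v) i = a \<otimes> v i" "\<zero>\<^bsub>?F\<^esub> i = \<zero>" for v w a i
    by (simp_all add: free_module_def)
  have vc: "v i \<in> carrier R" if "v \<in> carrier ?F" for v i
    using that by (simp add: free_module_def)
  have "abelian_group ?P"
  proof (rule abelian_groupI)
    fix v assume v: "v \<in> carrier ?P"
    \<comment> \<open>Closure under negatives: the negative taken in the free module has the ring
      negative as its coordinate at \<open>k\<close>, and this is again fixed by right
      multiplication by \<open>e\<close>.\<close>
    let ?w = "\<ominus>\<^bsub>?F\<^esub> v"
    have w: "?w \<in> carrier ?F" "?w \<oplus>\<^bsub>?F\<^esub> v = \<zero>\<^bsub>?F\<^esub>" using v by (auto simp: car F.M.l_neg)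
    then have "?w k \<oplus> v k = \<zero>" by (metis ap(1,3))
    then have "?w k = \<ominus> v k" using v w by (metis car vc minus_equality)
    then have "?w \<in> carrier ?P" using v w e by (simp add: car l_minus vc)
    then show "\<exists>y\<in>carrier ?P. y \<oplus>\<^bsub>?P\<^esub> v = \<zero>\<^bsub>?P\<^esub>" using w by (auto simp: op)
  qed (use e in \<open>auto simp: car op ap vc l_distr F.M.a_ac\<close>)
  then show ?thesis
    by (intro left_module.intro left_module_axioms.intro ring_axioms)
      (use e in \<open>auto simp: car op ap vc m_assoc F.smult_closed F.smult_l_distr F.smult_r_distr
        F.smult_assoc F.smult_one\<close>)
qed

text \<open>The identity \<open>v e = v\<close> on the left ideal is itself the expansion of
  \<open>v\<close> in the single element \<open>e\<close>, with the inclusion into the ring as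
  functional. The diagonal value is therefore \<open>e\<close>.\<close>

lemma (in ring) idem_module_dual_basis:
  assumes e: "e \<in> carrier R" "e \<otimes> e = e"
  shows "dual_basis R (idem_module R e k) {()} (\<lambda>_ i. if i = k then e else \<zero>) (\<lambda>_ v. v k)"
proof -
  let ?P = "idem_module R e k" and ?x = "\<lambda>i. if i = k then e else \<zero>"
  interpret P: left_module R ?P by (rule left_module_idem_module) fact
  have car: "v \<in> carrier ?P \<longleftrightarrow> (v k \<in> carrier R \<and> (\<forall>i. i \<noteq> k \<longrightarrow> v i = \<zero>)) \<and> v k \<otimes> e = v k" for v
    by (simp add: idem_module_def free_module_singleton_iff)
  have x: "?x \<in> carrier ?P" using e by (simp add: car)
  have "v = (\<Oplus>\<^bsub>?P\<^esub>u\<in>{()}. v k \<odot>\<^bsub>?P\<^esub> ?x)" if v: "v \<in> carrier ?P" for v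
  proof -
    have "v k \<odot>\<^bsub>?P\<^esub> ?x \<in> carrier ?P" using v x by (intro P.smult_closed) (auto simp: car)
    then have "(\<Oplus>\<^bsub>?P\<^esub>u\<in>{()}. v k \<odot>\<^bsub>?P\<^esub> ?x) = v k \<odot>\<^bsub>?P\<^esub> ?x"
      by (simp add: P.M.finsum_insert)
    also have "\<dots> = v" using v by (auto simp: car fun_eq_iff) (auto simp: idem_module_def free_module_def)
    finally show ?thesis by simp
  qed
  moreover have "linear_functional R ?P (\<lambda>v. v k)"
    unfolding linear_functional_def by (auto simp: car) (auto simp: idem_module_def free_module_def)
  ultimately show ?thesis using x by (simp add: dual_basis_def)
qed

lemma (in ring) finitely_generated_idem_module:
  assumes e: "e \<in> carrier R" "e \<otimes> e = e"
  shows "finitely_generated R (idem_module R e k)"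
proof -
  let ?P = "idem_module R e k" and ?x = "\<lambda>i. if i = k then e else \<zero>"
  interpret P: left_module R ?P by (rule left_module_idem_module) fact
  have D: "?x \<in> carrier ?P" "\<And>v. v \<in> carrier ?P \<Longrightarrow> v k \<in> carrier R"
    and ex: "\<And>v. v \<in> carrier ?P \<Longrightarrow> v = (\<Oplus>\<^bsub>?P\<^esub>u\<in>{()}. v k \<odot>\<^bsub>?P\<^esub> ?x)"
    using idem_module_dual_basis[OF e, of k] by (auto simp: dual_basis_def linear_functional_def)
  have "v = (\<Oplus>\<^bsub>?P\<^esub>a\<in>{?x}. v k \<odot>\<^bsub>?P\<^esub> a)" if v: "v \<in> carrier ?P" for v
  proof -
    have "v k \<odot>\<^bsub>?P\<^esub> ?x \<in> carrier ?P" using D v by (intro P.smult_closed)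
    then have "(\<Oplus>\<^bsub>?P\<^esub>a\<in>{?x}. v k \<odot>\<^bsub>?P\<^esub> a) = (\<Oplus>\<^bsub>?P\<^esub>u\<in>{()}. v k \<odot>\<^bsub>?P\<^esub> ?x)"
      by (subst (1 2) P.M.finsum_insert) (auto simp: P.M.finsum_empty)
    then show ?thesis using ex[OF v] by simp
  qed
  then show ?thesis
    unfolding finitely_generated_def
  proof (intro exI[of _ "{?x}"] conjI ballI)
    fix v assume "v \<in> carrier ?P"
    with \<open>\<And>v. v \<in> carrier ?P \<Longrightarrow> v = (\<Oplus>\<^bsub>?P\<^esub>a\<in>{?x}. v k \<odot>\<^bsub>?P\<^esub> a)\<close> D(2)
    show "\<exists>c\<in>{?x} \<rightarrow> carrier R. v = (\<Oplus>\<^bsub>?P\<^esub>a\<in>{?x}. c a \<odot>\<^bsub>?P\<^esub> a)"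
      by (intro bexI[of _ "\<lambda>_. v k"]) blast+
  qed (use D in auto)
qed

lemma (in ring) projective_idem_module:
  fixes k :: 'i
  assumes e: "e \<in> carrier R" "e \<otimes> e = e"
  shows "projective R (idem_module R e k)"
proof -
  let ?P = "idem_module R e k"
  \<comment> \<open>The complement of \<open>R e\<close> in \<open>R\<close> is \<open>R (1 - e)\<close>; \<open>l\<close> is an arbitrary index.\<close>
  define l :: "'i \<Rightarrow> 'a" where "l = (\<lambda>_. \<zero>)"
  let ?e' = "\<one> \<ominus> e"
  \<comment> \<open>The definition of \<open>projective\<close> takes its basis from the element
    type of the module, so the complement and the free module are placed over \<open>l\<close> and
    not over \<open>k\<close>.\<close>
  let ?N = "idem_module R ?e' l" and ?F = "free_module R {l}"
  have e': "?e' \<in> carrier R" using e by simp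
  have mult_e': "a \<otimes> ?e' = a \<ominus> a \<otimes> e" if "a \<in> carrier R" for a
    using that e by (simp add: minus_eq r_distr r_minus)
  have N: "left_module R ?N" by (rule left_module_idem_module) fact
  have carP: "v \<in> carrier ?P \<longleftrightarrow> (v k \<in> carrier R \<and> (\<forall>i. i \<noteq> k \<longrightarrow> v i = \<zero>)) \<and> v k \<otimes> e = v k" for v
    by (simp add: idem_module_def free_module_singleton_iff)
  \<comment> \<open>Being fixed by right multiplication by \<open>1 - e\<close> is the same as being
    annihilated by \<open>e\<close>; this form drives the computations below.\<close>
  have carN: "w \<in> carrier ?N \<longleftrightarrow> (w l \<in> carrier R \<and> (\<forall>i. i \<noteq> l \<longrightarrow> w i = \<zero>)) \<and> w l \<otimes> e = \<zero>" for w
  proof -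
    have "w l \<otimes> ?e' = w l \<longleftrightarrow> w l \<otimes> e = \<zero>" if w: "w l \<in> carrier R"
    proof
      assume "w l \<otimes> ?e' = w l"
      then have "w l \<oplus> \<ominus> (w l \<otimes> e) = w l" using mult_e'[OF w] by (simp add: minus_eq)
      then have "\<ominus> (w l \<otimes> e) = \<zero>" using w e by (metis add.l_cancel_one' a_inv_closed m_closed)
      then show "w l \<otimes> e = \<zero>" using w e by (metis minus_minus minus_zero m_closed)
    next
      assume "w l \<otimes> e = \<zero>"
      then show "w l \<otimes> ?e' = w l" using mult_e'[OF w] w by (simp add: minus_eq)
    qed
    then show ?thesis by (auto simp: idem_module_def free_module_singleton_iff)
  qed
  \<comment> \<open>\<open>\<phi>\<close> adds the two components inside the ring, and its inverse
    \<open>\<psi>\<close> splits \<open>a\<close> into \<open>a e\<close> and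
    \<open>a - a e\<close>.\<close>
  define \<phi> where "\<phi> = (\<lambda>(v :: 'i \<Rightarrow> 'a, w :: ('i \<Rightarrow> 'a) \<Rightarrow> 'a) i. if i = l then v k \<oplus> w l else \<zero>)"
  define \<psi> where "\<psi> = (\<lambda>u :: ('i \<Rightarrow> 'a) \<Rightarrow> 'a.
    ((\<lambda>i. if i = k then u l \<otimes> e else \<zero>), (\<lambda>i. if i = l then u l \<ominus> u l \<otimes> e else \<zero>)))"
  have "bij_betw \<phi> (carrier (direct_sum ?P ?N)) (carrier ?F)"
  proof (rule bij_betw_byWitness[where f' = \<psi>])
    show "\<forall>z\<in>carrier (direct_sum ?P ?N). \<psi> (\<phi> z) = z"
    proof
      fix z assume "z \<in> carrier (direct_sum ?P ?N)"
      then obtain v w where z: "z = (v, w)" and v: "v \<in> carrier ?P" and w: "w \<in> carrier ?N"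
        by (auto simp: direct_sum_def)
      have "(v k \<oplus> w l) \<otimes> e = v k" using v w e by (simp add: carP carN l_distr)
      moreover have "(v k \<oplus> w l) \<ominus> v k = w l"
        using v[unfolded carP] w[unfolded carN] by (simp add: minus_eq a_assoc r_neg a_comm[of "v k" "w l"])
      ultimately show "\<psi> (\<phi> z) = z" using v w by (auto simp: z \<phi>_def \<psi>_def carP carN)
    qed
    show "\<forall>u\<in>carrier ?F. \<phi> (\<psi> u) = u"
    proof
      fix u assume u: "u \<in> carrier ?F"
      then have ul: "u l \<in> carrier R" by (simp add: free_module_singleton_iff)
      have "u l \<otimes> e \<oplus> (u l \<ominus> u l \<otimes> e) = u l"
        using ul e by (simp add: minus_eq a_ac r_neg1 r_neg2 r_neg a_lcomm)
      then show "\<phi> (\<psi> u) = u" using u by (auto simp: \<phi>_def \<psi>_def free_module_singleton_iff)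
    qed
    show "\<phi> ` carrier (direct_sum ?P ?N) \<subseteq> carrier ?F"
      by (auto simp: \<phi>_def direct_sum_def carP carN free_module_singleton_iff)
    show "\<psi> ` carrier ?F \<subseteq> carrier (direct_sum ?P ?N)"
    proof -
      have "(a \<ominus> a \<otimes> e) \<otimes> e = \<zero>" if "a \<in> carrier R" for a
        using that e by (simp add: minus_eq l_distr m_assoc l_minus r_neg)
      then show ?thesis
        using e by (auto simp: \<psi>_def direct_sum_def carP carN free_module_singleton_iff m_assoc)
    qed
  qed
  moreover have "\<phi> (x \<oplus>\<^bsub>direct_sum ?P ?N\<^esub> y) = \<phi> x \<oplus>\<^bsub>?F\<^esub> \<phi> y"
    if "x \<in> carrier (direct_sum ?P ?N)" "y \<in> carrier (direct_sum ?P ?N)" for x y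
    using that by (auto simp: direct_sum_def carP carN)
      (auto simp: \<phi>_def idem_module_def free_module_def fun_eq_iff a_ac)
  moreover have "\<phi> (a \<odot>\<^bsub>direct_sum ?P ?N\<^esub> x) = a \<odot>\<^bsub>?F\<^esub> \<phi> x"
    if "a \<in> carrier R" "x \<in> carrier (direct_sum ?P ?N)" for a x
    using that by (auto simp: direct_sum_def carP carN)
      (auto simp: \<phi>_def idem_module_def free_module_def fun_eq_iff r_distr)
  ultimately show ?thesis
    unfolding projective_def module_isomorphic_def using N by blast
qed

lemma (in ring) idem_module_fg_projective:
  assumes "e \<in> carrier R" "e \<otimes> e = e"
  shows "idem_module R e k \<in> fg_projectives R"
  using assms by (simp add: fg_projectives_def left_module_idem_module
      finitely_generated_idem_module projective_idem_module)

lemma (in ring_trace) hs_rank_idem_module: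
  assumes "e \<in> carrier R" "e \<otimes>\<^bsub>R\<^esub> e = e"
  shows "hs_rank (idem_module R e k) = \<tau> e"
  using hs_rank_eq[OF left_module_idem_module finitely_generated_idem_module
      projective_idem_module idem_module_dual_basis] assms by simp

section \<open>Traces on the group algebra\<close>

text \<open>The coefficient of a product at the identity runs over the pairs with
  \<open>y z = 1\<close>, and in a group this condition is symmetric in \<open>y\<close> and
  \<open>z\<close>.\<close>

lemma ring_trace_at_one:
  assumes "group G"
  shows "ring_trace (group_algebra G) (\<lambda>f. f \<one>\<^bsub>G\<^esub>)"
proof (intro ring_trace.intro ring_trace_axioms.intro ring_group_algebra assms)
  interpret group G by fact
  fix f h assume fh: "f \<in> carrier (group_algebra G)" "h \<in> carrier (group_algebra G)"
  show "(f \<oplus>\<^bsub>group_algebra G\<^esub> h) \<one>\<^bsub>G\<^esub> = f \<one>\<^bsub>G\<^esub> + h \<one>\<^bsub>G\<^esub>" by (simp add: group_algebra_def)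
  have fin: "finite {x. f x \<noteq> 0}" "finite {x. h x \<noteq> 0}"
    and sub: "{x. f x \<noteq> 0} \<subseteq> carrier G" "{x. h x \<noteq> 0} \<subseteq> carrier G"
    using fh by (auto simp: group_algebra_def)
  have inv: "y \<otimes>\<^bsub>G\<^esub> z = \<one>\<^bsub>G\<^esub> \<longleftrightarrow> z \<otimes>\<^bsub>G\<^esub> y = \<one>\<^bsub>G\<^esub>" if "y \<in> carrier G" "z \<in> carrier G" for y z
    using that by (metis inv_comm)
  show "(f \<otimes>\<^bsub>group_algebra G\<^esub> h) \<one>\<^bsub>G\<^esub> = (h \<otimes>\<^bsub>group_algebra G\<^esub> f) \<one>\<^bsub>G\<^esub>"
    unfolding group_algebra_mult_eq[OF fin order_refl order_refl]
      group_algebra_mult_eq[OF fin(2,1) order_refl order_refl]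
    using sub by (subst sum.swap) (auto 0 3 intro!: sum.cong simp: inv subset_iff)
qed

definition augmentation :: "('g \<Rightarrow> complex) \<Rightarrow> complex"
  where "augmentation f = (\<Sum>x | f x \<noteq> 0. f x)"

lemma augmentation_superset:
  assumes "finite A" "{x. f x \<noteq> 0} \<subseteq> A"
  shows "augmentation f = (\<Sum>x\<in>A. f x)"
  unfolding augmentation_def using assms by (intro sum.mono_neutral_left) auto

text \<open>Every pair \<open>(y, z)\<close> from the two supports contributes to exactly one
  coefficient of the product, so summing all coefficients sums over all pairs.\<close>

lemma augmentation_mult:
  assumes "group G" "f \<in> carrier (group_algebra G)" "h \<in> carrier (group_algebra G)"
  shows "augmentation (f \<otimes>\<^bsub>group_algebra G\<^esub> h) = augmentation f * augmentation h"
proof -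
  let ?A = "{x. f x \<noteq> 0}" and ?B = "{x. h x \<noteq> 0}"
  let ?C = "(\<lambda>(y, z). y \<otimes>\<^bsub>G\<^esub> z) ` (?A \<times> ?B)"
  have fin: "finite ?A" "finite ?B" "finite ?C"
    using assms by (auto simp: group_algebra_def)
  have sup: "{x. (f \<otimes>\<^bsub>group_algebra G\<^esub> h) x \<noteq> 0} \<subseteq> ?C"
  proof
    fix x assume "x \<in> {x. (f \<otimes>\<^bsub>group_algebra G\<^esub> h) x \<noteq> 0}"
    then have "(\<Sum>y\<in>?A. \<Sum>z\<in>?B. if y \<otimes>\<^bsub>G\<^esub> z = x then f y * h z else 0) \<noteq> 0"
      by (simp add: group_algebra_mult_eq[OF fin(1,2) order_refl order_refl])
    then obtain y z where "y \<in> ?A" "z \<in> ?B" "y \<otimes>\<^bsub>G\<^esub> z = x"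
      by (elim sum.not_neutral_contains_not_neutral) (auto split: if_splits)
    then show "x \<in> ?C" by force
  qed
  have "augmentation (f \<otimes>\<^bsub>group_algebra G\<^esub> h) =
      (\<Sum>x\<in>?C. \<Sum>y\<in>?A. \<Sum>z\<in>?B. if y \<otimes>\<^bsub>G\<^esub> z = x then f y * h z else 0)"
    unfolding augmentation_superset[OF fin(3) sup]
    by (simp add: group_algebra_mult_eq[OF fin(1,2) order_refl order_refl])
  also have "\<dots> = (\<Sum>y\<in>?A. \<Sum>z\<in>?B. \<Sum>x\<in>?C. if y \<otimes>\<^bsub>G\<^esub> z = x then f y * h z else 0)"
    unfolding sum.swap[of _ _ ?C] ..
  also have "\<dots> = (\<Sum>y\<in>?A. \<Sum>z\<in>?B. f y * h z)"
    using fin(3) by (intro sum.cong refl) (force simp: sum.delta')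
  also have "\<dots> = augmentation f * augmentation h"
    by (simp add: augmentation_def sum_product)
  finally show ?thesis .
qed

text \<open>A multiplicative map into a commutative ring does not see the order of factors.\<close>

lemma ring_trace_augmentation:
  assumes "group G"
  shows "ring_trace (group_algebra G) augmentation"
proof (intro ring_trace.intro ring_trace_axioms.intro ring_group_algebra assms)
  fix f h assume fh: "f \<in> carrier (group_algebra G)" "h \<in> carrier (group_algebra G)"
  show "augmentation (f \<otimes>\<^bsub>group_algebra G\<^esub> h) = augmentation (h \<otimes>\<^bsub>group_algebra G\<^esub> f)"
    using fh by (simp add: augmentation_mult[OF assms])
  let ?S = "{x. f x \<noteq> 0} \<union> {x. h x \<noteq> 0}"
  have fin: "finite ?S" using fh by (auto simp: group_algebra_def)
  have "augmentation (\<lambda>x. f x + h x) = (\<Sum>x\<in>?S. f x + h x)"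
    using fin by (intro augmentation_superset) auto
  also have "\<dots> = augmentation f + augmentation h"
    using fin by (simp add: sum.distrib augmentation_superset[of ?S])
  finally show "augmentation (f \<oplus>\<^bsub>group_algebra G\<^esub> h) = augmentation f + augmentation h"
    by (simp add: group_algebra_def)
qed

section \<open>Averaging idempotents of finite subgroups\<close>

definition subgroup_average :: "'g set \<Rightarrow> 'g \<Rightarrow> complex"
  where "subgroup_average H x = (if x \<in> H then 1 / of_nat (card H) else 0)"

text \<open>For \<open>x\<close> and \<open>y\<close> in \<open>H\<close> exactly one
  \<open>z\<close> in \<open>H\<close> satisfies \<open>y z = x\<close>. So the coefficient at
  \<open>x\<close> collects \<open>card H\<close> terms, each the square of
  \<open>1 / card H\<close>; outside \<open>H\<close> there are no solutions.\<close>

lemma subgroup_average_idempotent: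
  assumes "group G" "subgroup H G" "finite H"
  shows "subgroup_average H \<otimes>\<^bsub>group_algebra G\<^esub> subgroup_average H = subgroup_average H"
proof
  interpret group G by fact
  interpret H: subgroup H G by fact
  fix x
  let ?n = "of_nat (card H) :: complex" and ?e = "subgroup_average H"
  have n: "?n \<noteq> 0" using assms(3) H.one_closed by (metis card_0_eq empty_iff of_nat_eq_0_iff)
  have supp: "{x. ?e x \<noteq> 0} \<subseteq> H" by (auto simp: subgroup_average_def)
  have "(?e \<otimes>\<^bsub>group_algebra G\<^esub> ?e) x = (\<Sum>y\<in>H. \<Sum>z\<in>H. if y \<otimes>\<^bsub>G\<^esub> z = x then 1 / ?n * (1 / ?n) else 0)"
    unfolding group_algebra_mult_eq[OF assms(3) assms(3) supp supp]
    by (intro sum.cong refl) (auto simp: subgroup_average_def)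
  also have "\<dots> = (\<Sum>y\<in>H. if x \<in> H then 1 / ?n * (1 / ?n) else 0)"
  proof (intro sum.cong refl)
    fix y assume y: "y \<in> H"
    show "(\<Sum>z\<in>H. if y \<otimes>\<^bsub>G\<^esub> z = x then 1 / ?n * (1 / ?n) else 0) =
      (if x \<in> H then 1 / ?n * (1 / ?n) else 0)"
    proof (cases "x \<in> H")
      case True
      have "y \<otimes>\<^bsub>G\<^esub> z = x \<longleftrightarrow> z = inv\<^bsub>G\<^esub> y \<otimes>\<^bsub>G\<^esub> x" if "z \<in> H" for z
        using that y True by (metis H.mem_carrier inv_solve_left)
      then have "(\<Sum>z\<in>H. if y \<otimes>\<^bsub>G\<^esub> z = x then 1 / ?n * (1 / ?n) else 0) =
        (\<Sum>z\<in>H. if z = inv\<^bsub>G\<^esub> y \<otimes>\<^bsub>G\<^esub> x then 1 / ?n * (1 / ?n) else 0)"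
        by (intro sum.cong) auto
      then show ?thesis using True y assms(3) by simp
    next
      case False
      then have "y \<otimes>\<^bsub>G\<^esub> z \<noteq> x" if "z \<in> H" for z using y that by auto
      then show ?thesis using False by simp
    qed
  qed
  also have "\<dots> = ?e x" using n by (simp add: subgroup_average_def)
  finally show "(?e \<otimes>\<^bsub>group_algebra G\<^esub> ?e) x = ?e x" .
qed

lemma subgroup_average_closed:
  assumes "subgroup H G" "finite H"
  shows "subgroup_average H \<in> carrier (group_algebra G)"
proof -
  have "{x. subgroup_average H x \<noteq> 0} \<subseteq> H" by (auto simp: subgroup_average_def)
  then show ?thesis
    using assms subgroup.subset[OF assms(1)] by (auto simp: group_algebra_def intro: finite_subset)
qed

lemma augmentation_subgroup_average:
  assumes "finite H" "H \<noteq> {}"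
  shows "augmentation (subgroup_average H) = 1"
proof -
  have "augmentation (subgroup_average H) = (\<Sum>x\<in>H. subgroup_average H x)"
    using assms by (intro augmentation_superset) (auto simp: subgroup_average_def)
  then show ?thesis using assms by (simp add: subgroup_average_def)
qed

section \<open>Comparison of the two ranks\<close>

lemma K0_integer_finite_subgroup_trivial:
  assumes "group G" and K0: "K0 (group_algebra G) \<cong> integer_group"
    and H: "subgroup H G" "finite H"
  shows "card H = 1"
proof -
  interpret group G by fact
  let ?R = "group_algebra G" and ?e = "subgroup_average H"
  interpret T: ring_trace ?R "\<lambda>f. f \<one>\<^bsub>G\<^esub>" by (rule ring_trace_at_one) fact
  interpret E: ring_trace ?R augmentation by (rule ring_trace_augmentation) fact
  have e: "?e \<in> carrier ?R" "?e \<otimes>\<^bsub>?R\<^esub> ?e = ?e"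
    by (simp_all add: subgroup_average_closed subgroup_average_idempotent H assms(1))
  have one: "\<one>\<^bsub>?R\<^esub> \<in> carrier ?R" "\<one>\<^bsub>?R\<^esub> \<otimes>\<^bsub>?R\<^esub> \<one>\<^bsub>?R\<^esub> = \<one>\<^bsub>?R\<^esub>" by simp_all
  \<comment> \<open>The unit is the average over the trivial subgroup, so its augmentation comes
    from the same lemma as that of \<open>?e\<close>.\<close>
  have one_eq: "\<one>\<^bsub>?R\<^esub> = subgroup_average {\<one>\<^bsub>G\<^esub>}"
    by (auto simp: group_algebra_def subgroup_average_def fun_eq_iff)
  have nonempty: "\<one>\<^bsub>G\<^esub> \<in> H" using H subgroup.one_closed by blast
  have val: "?e \<one>\<^bsub>G\<^esub> = 1 / of_nat (card H)" "augmentation ?e = 1"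
    "\<one>\<^bsub>?R\<^esub> \<one>\<^bsub>G\<^esub> = 1" "augmentation \<one>\<^bsub>?R\<^esub> = 1"
    using nonempty H augmentation_subgroup_average[of H] augmentation_subgroup_average[of "{\<one>\<^bsub>G\<^esub>}"]
    by (auto simp: one_eq subgroup_average_def)
  define P where "P = idem_module ?R ?e (0 :: nat)"
  \<comment> \<open>For the idempotent \<open>1\<close> the module is the free module of rank
    one.\<close>
  define Q where "Q = idem_module ?R \<one>\<^bsub>?R\<^esub> (0 :: nat)"
  have PQ: "P \<in> fg_projectives ?R" "Q \<in> fg_projectives ?R"
    unfolding P_def Q_def by (intro T.idem_module_fg_projective e one)+
  have rank: "T.hs_rank P = 1 / of_nat (card H)" "T.hs_rank Q = 1" "E.hs_rank P = 1" "E.hs_rank Q = 1"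
    using T.hs_rank_idem_module[OF e] T.hs_rank_idem_module[OF one]
      E.hs_rank_idem_module[OF e] E.hs_rank_idem_module[OF one] by (simp_all add: P_def Q_def val)
  obtain \<theta> :: "_ \<Rightarrow> int" where
    cmul: "\<And>c n. Poly_Mapping.keys c \<subseteq> fg_projectives ?R \<Longrightarrow> \<theta> (frag_cmul n c) = n * \<theta> c" and
    add: "\<And>c d. Poly_Mapping.keys c \<subseteq> fg_projectives ?R \<Longrightarrow> Poly_Mapping.keys d \<subseteq> fg_projectives ?R \<Longrightarrow>
      \<theta> (c + d) = \<theta> c + \<theta> d" and
    ker: "\<And>c. Poly_Mapping.keys c \<subseteq> fg_projectives ?R \<Longrightarrow> \<theta> c = 0 \<Longrightarrow>
      c \<in> generate (free_Abelian_group (fg_projectives ?R)) (K0_relations ?R)"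
    using K0_integer_hom[OF K0] by blast
  define p q where "p = \<theta> (frag_of P)" and "q = \<theta> (frag_of Q)"
  \<comment> \<open>The integer relation that any two elements of an infinite cyclic group satisfy:
    the image of \<open>c\<close> is \<open>q p - p q = 0\<close>, so both ranks must vanish on
    \<open>c\<close>.\<close>
  define c where "c = frag_cmul q (frag_of P) + frag_cmul (- p) (frag_of Q)"
  have keys: "Poly_Mapping.keys (frag_cmul q (frag_of P)) \<subseteq> fg_projectives ?R"
    "Poly_Mapping.keys (frag_cmul (- p) (frag_of Q)) \<subseteq> fg_projectives ?R"
    using PQ by (auto split: if_splits)
  have "Poly_Mapping.keys c \<subseteq> fg_projectives ?R"
    unfolding c_def by (rule order_trans[OF keys_add Un_least[OF keys]])
  moreover have "\<theta> c = 0"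
    unfolding c_def using PQ by (simp only: add[OF keys] cmul keys_frag_of) (simp add: cmul p_def q_def)
  ultimately have c: "c \<in> generate (free_Abelian_group (fg_projectives ?R)) (K0_relations ?R)"
    by (rule ker)
  \<comment> \<open>The relation has to be nontrivial. If \<open>q\<close> were zero, the class of
    the free module would vanish, although its augmentation rank is \<open>1\<close>.\<close>
  have "q \<noteq> 0"
  proof
    assume "q = 0"
    then have "E.K0_rank (frag_of Q) = 0" using PQ by (intro E.K0_rank_relations ker) (auto simp: q_def)
    then show False by (simp add: rank)
  qed
  \<comment> \<open>The augmentation forces \<open>q = p\<close>, while the coefficient at the
    identity forces \<open>q / card H = p\<close>.\<close>
  have "E.K0_rank c = of_int q - of_int p" "T.K0_rank c = of_int q / of_nat (card H) - of_int p"
    by (simp_all only: c_def E.K0_rank_add T.K0_rank_add E.K0_rank_cmul T.K0_rank_cmul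
        E.K0_rank_frag_of T.K0_rank_frag_of rank) simp_all
  then have "(of_int q :: complex) = of_int p" "(of_int q / of_nat (card H) :: complex) = of_int p"
    using E.K0_rank_relations[OF c] T.K0_rank_relations[OF c] by simp_all
  then have "(of_int q / of_nat (card H) :: complex) = of_int q" by simp
  \<comment> \<open>Division by zero yields zero, so the case \<open>card H = 0\<close> would give
    \<open>q = 0\<close> and is excluded as well.\<close>
  then have "(of_nat (card H) :: complex) = 1"
    using \<open>q \<noteq> 0\<close> by (cases "card H = 0") (auto simp: field_simps)
  then show ?thesis by simp
qed

theorem mainTheorem12:
  fixes \<Gamma> :: "('g, 'b) monoid_scheme"
  assumes "group \<Gamma>"
    and "virtually_torsion_free \<Gamma>"
    and "finite (finite_subgroup_conjugacy_classes \<Gamma>)"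
    and "K0 (group_algebra \<Gamma>) \<cong> integer_group"
  shows "torsion_free \<Gamma>"
proof -
  interpret group \<Gamma> by fact
  show ?thesis
    unfolding torsion_free_def
  proof (intro ballI allI impI)
    fix x and n :: nat
    assume x: "x \<in> carrier \<Gamma>" and n: "0 < n \<and> x [^]\<^bsub>\<Gamma>\<^esub> n = \<one>\<^bsub>\<Gamma>\<^esub>"
    \<comment> \<open>Since \<open>ord\<close> is \<open>0\<close> exactly for elements of infinite
      order, \<open>x\<close> generates a subgroup of nonzero cardinality \<open>ord x\<close>; an
      infinite subgroup would have cardinality \<open>0\<close>.\<close>
    then have "ord x \<noteq> 0" using ord_eq_0 by auto
    then have "finite (generate \<Gamma> {x})"
      using generate_pow_card[OF x] by (metis card.infinite)
    moreover have "subgroup (generate \<Gamma> {x}) \<Gamma>" using x by (intro generate_is_subgroup) simp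
    ultimately have "card (generate \<Gamma> {x}) = 1"
      using K0_integer_finite_subgroup_trivial assms(1,4) by blast
    then show "x = \<one>\<^bsub>\<Gamma>\<^esub>"
      using ord_eq_1[OF x] generate_pow_card[OF x] by simp
  qed
qed

end
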